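(* Let $E$ be a topological vector space (which need not be locally convex) and let $U\subseteq E$ be a subset such that (a) $U$ is open, or (b) $U$ is semi-locally convex, i.e., each $p\in U$ has a neighbourhood (relative to $U$) which is a convex subset of $E$. Let $E_\infty$ be a vector subspace of $E$ such that $U_\infty:=U\cap E_\infty$ is dense in $U$. Endow $U_\infty$ with the topology $\mathcal{O}$ induced by the finite topology on $E_\infty$. Then the inclusion map $(U_\infty,\mathcal{O})\to U$ is a weak homotopy equivalence. Furthermore, $$\pi_k(U,p)=\varinjlim_{F\in\mathcal{F}_p}\pi_k(U\cap F,p)\quad\text{for each }k\in\mathbb{N}_0\text{ and }p\in U_\infty,$$ where $\mathcal{F}_p$ is the set of all finite-dimensional vector subspaces $F\subseteq E_\infty$ with $p\in F$.
   Context: All topological spaces are Hausdorff and topological vector spaces are real; $\mathbb{N}_0=\{0,1,2,\dots\}$. The finite topology on a vector space $E_\infty$ is the final topology with respect to the inclusion maps $F\to E_\infty$ of its finite-dimensional vector subspaces $F$ (each with its unique Hausdorff vector topology). $U$ carries the topology induced by $E$, and $U\cap F$ the topology induced by $F$. The set $\mathcal{F}_p$ is directed by inclusion. A continuous map $f:X\to Y$ is a weak homotopy equivalence if $f_*:\pi_k(X,p)\to\pi_k(Y,f(p))$ is a bijection for all $k\in\mathbb{N}_0$ and $p\in X$. The equality with the direct limit means that $\pi_k(U,p)$, with the maps induced by the inclusions $U\cap F\to U$, is a direct limit of the direct system of the $\pi_k(U\cap F,p)$ (with bonding maps induced by inclusions), in the category of groups if $k\ge1$ and in the category of sets if $k=0$.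 *)

theory Defs
  imports "HOL-Analysis.Analysis" "HOL-Algebra.Group"
begin

section \<open>Topological vector spaces and the finite topology\<close>

class real_tvs = real_vector + topological_ab_group_add + t2_space +
  assumes tendsto_scaleR_Pair: "LIM x (nhds r \<times>\<^sub>F nhds a). fst x *\<^sub>R snd x :> nhds (r *\<^sub>R a)"

definition semi_locally_convex :: "'a::real_tvs set \<Rightarrow> bool" where
  "semi_locally_convex U \<longleftrightarrow>
     (\<forall>p\<in>U. \<exists>C W. convex C \<and> C \<subseteq> U \<and> openin (top_of_set U) W \<and> p \<in> W \<and> W \<subseteq> C)"

definition fin_dim_subspace :: "'a::real_vector set \<Rightarrow> bool" where
  "fin_dim_subspace F \<longleftrightarrow> (\<exists>B. finite B \<and> F = span B)"

definition hausdorff_vector_topology :: "'a::real_vector set \<Rightarrow> 'a topology \<Rightarrow> bool" where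
  "hausdorff_vector_topology F T \<longleftrightarrow>
     topspace T = F \<and> Hausdorff_space T \<and>
     continuous_map (prod_topology T T) T (\<lambda>(x, y). x + y) \<and>
     continuous_map (prod_topology euclideanreal T) T (\<lambda>(r, x). r *\<^sub>R x)"

text \<open>Intended for finite-dimensional subspaces, where a Hausdorff vector topology exists and is
  unique. If \<open>F\<close> is a finite-dimensional subspace of a Hausdorff topological vector space, this is
  the topology induced on \<open>F\<close>, by the next lemma.\<close>

definition fin_dim_topology :: "'a::real_vector set \<Rightarrow> 'a topology" where
  "fin_dim_topology F = (THE T. hausdorff_vector_topology F T)"

lemma hausdorff_vector_topology_top_of_set:
  fixes F :: "'a::real_tvs set"
  assumes "subspace F"
  shows "hausdorff_vector_topology F (top_of_set F)"
proof -
  have add: "continuous_on (F \<times> F) (\<lambda>z::'a \<times> 'a. fst z + snd z)"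
    by (intro continuous_intros)
  have "((\<lambda>z. fst z *\<^sub>R snd z) \<longlongrightarrow> fst w *\<^sub>R snd w) (at w within UNIV \<times> F)" for w :: "real \<times> 'a"
    using tendsto_scaleR_Pair[of "fst w" "snd w"]
    unfolding nhds_prod[symmetric] prod.collapse
    by (auto intro: tendsto_mono[OF at_within_le_nhds])
  then have scale: "continuous_on (UNIV \<times> F) (\<lambda>z::real \<times> 'a. fst z *\<^sub>R snd z)"
    by (simp add: continuous_on_def)
  have "\<exists>V W. open V \<and> open W \<and> x \<in> V \<and> y \<in> W \<and> disjnt V W" if "x \<noteq> y" for x y :: 'a
    using hausdorff[OF that] by (simp add: disjnt_def)
  then have "Hausdorff_space (euclidean :: 'a topology)"
    by (simp add: Hausdorff_space_def)
  then have haus: "Hausdorff_space (top_of_set F)"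
    by (rule Hausdorff_space_subtopology)
  have "continuous_map (top_of_set (F \<times> F)) (top_of_set F) (\<lambda>z. fst z + snd z)"
    using add subspace_add[OF assms] by (auto simp: continuous_map_in_subtopology)
  moreover have "continuous_map (top_of_set (UNIV \<times> F)) (top_of_set F) (\<lambda>z::real \<times> 'a. fst z *\<^sub>R snd z)"
    using scale subspace_scale[OF assms] by (auto simp: continuous_map_in_subtopology)
  moreover have "prod_topology (top_of_set F) (top_of_set F) = top_of_set (F \<times> F)"
    by (rule prod_topology_subtopology_eu)
  moreover have "prod_topology euclideanreal (top_of_set F) = top_of_set (UNIV \<times> F)"
    using prod_topology_subtopology_eu[of "UNIV :: real set" F] by (simp only: subtopology_UNIV)
  ultimately show ?thesis
    using haus unfolding hausdorff_vector_topology_def case_prod_unfold by simp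
qed

definition fin_dim_subspaces_at :: "'a::real_vector set \<Rightarrow> 'a \<Rightarrow> 'a set set" where
  "fin_dim_subspaces_at V p = {F. fin_dim_subspace F \<and> F \<subseteq> V \<and> p \<in> F}"

definition fin_dim_part :: "'a::real_vector set \<Rightarrow> 'a set \<Rightarrow> 'a topology" where
  "fin_dim_part U F = subtopology (fin_dim_topology F) (U \<inter> F)"

text \<open>The final topology on \<open>V\<close> with respect to the inclusions of its finite-dimensional
  subspaces.\<close>

definition finite_topology :: "'a::real_vector set \<Rightarrow> 'a topology" where
  "finite_topology V = topology (\<lambda>W. W \<subseteq> V \<and>
     (\<forall>F. fin_dim_subspace F \<and> F \<subseteq> V \<longrightarrow> openin (fin_dim_topology F) (W \<inter> F)))"

lemma openin_finite_topology:
  "openin (finite_topology V) W \<longleftrightarrow> W \<subseteq> V \<and>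
     (\<forall>F. fin_dim_subspace F \<and> F \<subseteq> V \<longrightarrow> openin (fin_dim_topology F) (W \<inter> F))"
proof -
  define P where "P = (\<lambda>W. W \<subseteq> V \<and>
     (\<forall>F. fin_dim_subspace F \<and> F \<subseteq> V \<longrightarrow> openin (fin_dim_topology F) (W \<inter> F)))"
  have "P (S \<inter> T)" if "P S" "P T" for S T
  proof -
    have "openin (fin_dim_topology F) (S \<inter> T \<inter> F)" if "fin_dim_subspace F \<and> F \<subseteq> V" for F
    proof -
      have "openin (fin_dim_topology F) ((S \<inter> F) \<inter> (T \<inter> F))"
        by (rule openin_Int) (use \<open>P S\<close> \<open>P T\<close> that in \<open>simp_all add: P_def\<close>)
      moreover have "(S \<inter> F) \<inter> (T \<inter> F) = S \<inter> T \<inter> F"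
        by auto
      ultimately show ?thesis
        by simp
    qed
    then show ?thesis
      using that by (auto simp: P_def)
  qed
  moreover have "P (\<Union>\<K>)" if "\<forall>K\<in>\<K>. P K" for \<K>
  proof -
    have "openin (fin_dim_topology F) (\<Union>\<K> \<inter> F)" if "fin_dim_subspace F \<and> F \<subseteq> V" for F
      unfolding Int_Union2
      by (rule openin_Union) (use \<open>\<forall>K\<in>\<K>. P K\<close> that in \<open>auto simp: P_def\<close>)
    then show ?thesis
      using that by (auto simp: P_def)
  qed
  ultimately have "istopology P"
    by (simp add: istopology_def)
  then show ?thesis
    unfolding finite_topology_def P_def[symmetric] by (simp only: topology_inverse' P_def)
qed


section \<open>Homotopy groups and weak homotopy equivalences\<close>

text \<open>The cube \<open>[0,1]\<^sup>k\<close>; for \<open>k = 0\<close> it is a single point and its boundary is empty, so that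
  the homotopy classes below are the path components.\<close>

definition unit_cube :: "nat \<Rightarrow> (nat \<Rightarrow> real) topology" where
  "unit_cube k = product_topology (\<lambda>_. top_of_set {0..1}) {..<k}"

definition cube_boundary :: "nat \<Rightarrow> (nat \<Rightarrow> real) set" where
  "cube_boundary k = {x \<in> topspace (unit_cube k). \<exists>i<k. x i = 0 \<or> x i = 1}"

definition cube_maps :: "nat \<Rightarrow> 'a topology \<Rightarrow> 'a \<Rightarrow> ((nat \<Rightarrow> real) \<Rightarrow> 'a) set" where
  "cube_maps k X p = {f. continuous_map (unit_cube k) X f \<and> f ` cube_boundary k \<subseteq> {p}}"

definition cube_homotopic ::
  "nat \<Rightarrow> 'a topology \<Rightarrow> 'a \<Rightarrow> ((nat \<Rightarrow> real) \<Rightarrow> 'a) \<Rightarrow> ((nat \<Rightarrow> real) \<Rightarrow> 'a) \<Rightarrow> bool" where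
  "cube_homotopic k X p f g \<longleftrightarrow>
     homotopic_with (\<lambda>h. h ` cube_boundary k \<subseteq> {p}) (unit_cube k) X f g"

definition homotopy_set :: "nat \<Rightarrow> 'a topology \<Rightarrow> 'a \<Rightarrow> ((nat \<Rightarrow> real) \<Rightarrow> 'a) set set" where
  "homotopy_set k X p = cube_maps k X p // {(f, g). cube_homotopic k X p f g}"

definition cube_concat ::
  "((nat \<Rightarrow> real) \<Rightarrow> 'a) \<Rightarrow> ((nat \<Rightarrow> real) \<Rightarrow> 'a) \<Rightarrow> (nat \<Rightarrow> real) \<Rightarrow> 'a" where
  "cube_concat f g x =
     (if x 0 \<le> 1/2 then f (x(0 := 2 * x 0)) else g (x(0 := 2 * x 0 - 1)))"

text \<open>The group structure on \<open>homotopy_set k X p\<close>, meaningful only for \<open>k \<ge> 1\<close>.\<close>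

definition homotopy_group ::
  "nat \<Rightarrow> 'a topology \<Rightarrow> 'a \<Rightarrow> ((nat \<Rightarrow> real) \<Rightarrow> 'a) set monoid" where
  "homotopy_group k X p =
     \<lparr>carrier = homotopy_set k X p,
      monoid.mult = (\<lambda>A B. {h. \<exists>f\<in>A. \<exists>g\<in>B. cube_homotopic k X p (cube_concat f g) h}),
      one = {h. cube_homotopic k X p (\<lambda>_. p) h}\<rparr>"

text \<open>The map \<open>f\<^sub>*\<close> on homotopy classes, with values in the homotopy set of \<open>Y\<close> at \<open>q = f p\<close>.\<close>

definition homotopy_map ::
  "nat \<Rightarrow> 'b topology \<Rightarrow> 'b \<Rightarrow> ('a \<Rightarrow> 'b)
     \<Rightarrow> ((nat \<Rightarrow> real) \<Rightarrow> 'a) set \<Rightarrow> ((nat \<Rightarrow> real) \<Rightarrow> 'b) set" where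
  "homotopy_map k Y q f A = {h. \<exists>g\<in>A. cube_homotopic k Y q (f \<circ> g) h}"

definition weak_homotopy_equivalence :: "'a topology \<Rightarrow> 'b topology \<Rightarrow> ('a \<Rightarrow> 'b) \<Rightarrow> bool" where
  "weak_homotopy_equivalence X Y f \<longleftrightarrow>
     continuous_map X Y f \<and>
     (\<forall>k. \<forall>p \<in> topspace X.
        bij_betw (homotopy_map k Y (f p) f) (homotopy_set k X p) (homotopy_set k Y (f p)))"


section \<open>Direct limits of sets and of groups\<close>

definition directed_index :: "'i set \<Rightarrow> ('i \<Rightarrow> 'i \<Rightarrow> bool) \<Rightarrow> bool" where
  "directed_index I leq \<longleftrightarrow>
     I \<noteq> {} \<and> (\<forall>i\<in>I. leq i i) \<and>
     (\<forall>i\<in>I. \<forall>j\<in>I. \<forall>l\<in>I. leq i j \<longrightarrow> leq j l \<longrightarrow> leq i l) \<and>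
     (\<forall>i\<in>I. \<forall>j\<in>I. \<exists>l\<in>I. leq i l \<and> leq j l)"

definition direct_system_sets ::
  "'i set \<Rightarrow> ('i \<Rightarrow> 'i \<Rightarrow> bool) \<Rightarrow> ('i \<Rightarrow> 'x set) \<Rightarrow> ('i \<Rightarrow> 'i \<Rightarrow> 'x \<Rightarrow> 'x) \<Rightarrow> bool" where
  "direct_system_sets I leq A \<beta> \<longleftrightarrow>
     directed_index I leq \<and>
     (\<forall>i\<in>I. \<forall>j\<in>I. leq i j \<longrightarrow> \<beta> i j \<in> A i \<rightarrow> A j) \<and>
     (\<forall>i\<in>I. \<forall>x\<in>A i. \<beta> i i x = x) \<and>
     (\<forall>i\<in>I. \<forall>j\<in>I. \<forall>l\<in>I. leq i j \<longrightarrow> leq j l \<longrightarrow> (\<forall>x\<in>A i. \<beta> j l (\<beta> i j x) = \<beta> i l x))"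

definition cocone_sets ::
  "'i set \<Rightarrow> ('i \<Rightarrow> 'i \<Rightarrow> bool) \<Rightarrow> ('i \<Rightarrow> 'x set) \<Rightarrow> ('i \<Rightarrow> 'i \<Rightarrow> 'x \<Rightarrow> 'x)
     \<Rightarrow> 'y set \<Rightarrow> ('i \<Rightarrow> 'x \<Rightarrow> 'y) \<Rightarrow> bool" where
  "cocone_sets I leq A \<beta> S \<phi> \<longleftrightarrow>
     (\<forall>i\<in>I. \<phi> i \<in> A i \<rightarrow> S) \<and>
     (\<forall>i\<in>I. \<forall>j\<in>I. leq i j \<longrightarrow> (\<forall>x\<in>A i. \<phi> j (\<beta> i j x) = \<phi> i x))"

text \<open>The test objects of a universal property range over a type, which has to be a parameter of the
  definition. A theorem stated for \<open>TYPE('c)\<close> with \<open>'c\<close> a type variable asserts the universal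
  property with respect to test objects on every type.\<close>

definition direct_limit_sets ::
  "'c itself \<Rightarrow> 'i set \<Rightarrow> ('i \<Rightarrow> 'i \<Rightarrow> bool) \<Rightarrow> ('i \<Rightarrow> 'x set) \<Rightarrow> ('i \<Rightarrow> 'i \<Rightarrow> 'x \<Rightarrow> 'x)
     \<Rightarrow> 'y set \<Rightarrow> ('i \<Rightarrow> 'x \<Rightarrow> 'y) \<Rightarrow> bool" where
  "direct_limit_sets (_ :: 'c itself) I leq A \<beta> L \<psi> \<longleftrightarrow>
     direct_system_sets I leq A \<beta> \<and>
     cocone_sets I leq A \<beta> L \<psi> \<and>
     (\<forall>(S :: 'c set) \<phi>. cocone_sets I leq A \<beta> S \<phi> \<longrightarrow>
        (\<exists>!h. h \<in> L \<rightarrow>\<^sub>E S \<and> (\<forall>i\<in>I. \<forall>x\<in>A i. h (\<psi> i x) = \<phi> i x)))"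

definition direct_system_groups ::
  "'i set \<Rightarrow> ('i \<Rightarrow> 'i \<Rightarrow> bool) \<Rightarrow> ('i \<Rightarrow> 'x monoid) \<Rightarrow> ('i \<Rightarrow> 'i \<Rightarrow> 'x \<Rightarrow> 'x) \<Rightarrow> bool" where
  "direct_system_groups I leq G \<beta> \<longleftrightarrow>
     direct_system_sets I leq (\<lambda>i. carrier (G i)) \<beta> \<and>
     (\<forall>i\<in>I. group (G i)) \<and>
     (\<forall>i\<in>I. \<forall>j\<in>I. leq i j \<longrightarrow> \<beta> i j \<in> hom (G i) (G j))"

definition cocone_groups ::
  "'i set \<Rightarrow> ('i \<Rightarrow> 'i \<Rightarrow> bool) \<Rightarrow> ('i \<Rightarrow> 'x monoid) \<Rightarrow> ('i \<Rightarrow> 'i \<Rightarrow> 'x \<Rightarrow> 'x)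
     \<Rightarrow> 'y monoid \<Rightarrow> ('i \<Rightarrow> 'x \<Rightarrow> 'y) \<Rightarrow> bool" where
  "cocone_groups I leq G \<beta> H \<phi> \<longleftrightarrow>
     group H \<and>
     cocone_sets I leq (\<lambda>i. carrier (G i)) \<beta> (carrier H) \<phi> \<and>
     (\<forall>i\<in>I. \<phi> i \<in> hom (G i) H)"

definition direct_limit_groups ::
  "'c itself \<Rightarrow> 'i set \<Rightarrow> ('i \<Rightarrow> 'i \<Rightarrow> bool) \<Rightarrow> ('i \<Rightarrow> 'x monoid) \<Rightarrow> ('i \<Rightarrow> 'i \<Rightarrow> 'x \<Rightarrow> 'x)
     \<Rightarrow> 'y monoid \<Rightarrow> ('i \<Rightarrow> 'x \<Rightarrow> 'y) \<Rightarrow> bool" where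
  "direct_limit_groups (_ :: 'c itself) I leq G \<beta> L \<psi> \<longleftrightarrow>
     direct_system_groups I leq G \<beta> \<and>
     cocone_groups I leq G \<beta> L \<psi> \<and>
     (\<forall>(H :: 'c monoid) \<phi>. cocone_groups I leq G \<beta> H \<phi> \<longrightarrow>
        (\<exists>!h. h \<in> hom L H \<and> h \<in> extensional (carrier L) \<and>
              (\<forall>i\<in>I. \<forall>x\<in>carrier (G i). h (\<psi> i x) = \<phi> i x)))"

end

theory Submission
  imports Defs
begin

text \<open>
  A map \<open>f\<close> from a cube into \<open>U\<close> is approximated by
  \<open>g x = \<theta> x *\<^sub>R f (c x) + (1 - \<theta> x) *\<^sub>R (\<Sum>v. w v x *\<^sub>R y v)\<close>, where \<open>w\<close> is the partition of unity by
  tent functions centred at the points of a fine grid, \<open>y v \<in> U \<inter> E_inf\<close> is close to \<open>f v\<close>, \<open>c\<close>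
  pushes a collar of the boundary onto the boundary and \<open>\<theta>\<close> is a cut-off function supported in the
  collar and equal to 1 on the boundary. If \<open>f\<close> maps the boundary into a finite-dimensional space,
  then all values of \<open>g\<close> lie in a finite-dimensional space, and \<open>g = f\<close> on the boundary.
  In dimension \<open>k\<close> at most \<open>2 ^ k\<close> tents are nonzero at a point, so \<open>f x\<close> and \<open>g x\<close> lie in the
  convex hull of at most \<open>2 ^ k + 2\<close> points close to \<open>f x\<close>. Such hulls are contained in \<open>U\<close> if \<open>U\<close>
  is open or semi-locally convex, and \<open>f\<close> is homotopic to \<open>g\<close> in \<open>U\<close> relative to the boundary.
  Applied to maps of \<open>k\<close>-cubes this gives surjectivity, applied to homotopies, viewed as maps of
  \<open>(k + 1)\<close>-cubes, it gives injectivity. Finally, compact subsets of the finite topology are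
  contained in finite-dimensional subspaces.
\<close>

section \<open>Uniqueness of the finite-dimensional vector topology\<close>

text \<open>Without local convexity, every neighbourhood of a point may contain finite sets whose
  convex hull leaves \<open>U\<close>; continuity of the vector operations only controls
  combinations of a number of vectors fixed in advance. This dictates the order of the choices. The
  number \<open>2 ^ k + 2\<close> depends on the dimension alone, so the cover of the image by sets
  with good hulls of that many points can be chosen before the mesh of the grid, and refining the
  grid afterwards does not spoil the bound. The second difficulty is to keep the boundary values:
  tent averages of the \<open>y v\<close> do not reproduce \<open>f\<close> there, while
  \<open>f\<close> itself may leave every finite-dimensional space in the interior. Using
  \<open>f (c x)\<close> settles both, because wherever its coefficient is nonzero it is a boundary
  value of \<open>f\<close>. Finally, \<open>fin_dim_topology\<close> is a definite description of
  an abstract Hausdorff vector topology. It can be replaced by the induced topology only after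
  uniqueness has been proved, which is done by showing that coordinates with respect to a basis are
  continuous.\<close>

lemma continuous_map_vector_add:
  assumes "hausdorff_vector_topology F T" "continuous_map X T f" "continuous_map X T g"
  shows "continuous_map X T (\<lambda>x. f x + g x)"
proof -
  have "continuous_map X T ((\<lambda>(x, y). x + y) \<circ> (\<lambda>x. (f x, g x)))"
    using assms by (intro continuous_map_compose[where X' = "prod_topology T T"])
      (auto simp: hausdorff_vector_topology_def continuous_map_pairedI)
  then show ?thesis by (simp add: o_def)
qed

lemma continuous_map_vector_scaleR:
  assumes "hausdorff_vector_topology F T" "continuous_map X euclideanreal r" "continuous_map X T f"
  shows "continuous_map X T (\<lambda>x. r x *\<^sub>R f x)"
proof -
  have "continuous_map X T ((\<lambda>(x, y). x *\<^sub>R y) \<circ> (\<lambda>x. (r x, f x)))"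
    using assms by (intro continuous_map_compose[where X' = "prod_topology euclideanreal T"])
      (auto simp: hausdorff_vector_topology_def continuous_map_pairedI)
  then show ?thesis by (simp add: o_def)
qed

lemma continuous_map_vector_sum:
  assumes "hausdorff_vector_topology F T" "0 \<in> F" "finite I" "\<And>i. i \<in> I \<Longrightarrow> continuous_map X T (f i)"
  shows "continuous_map X T (\<lambda>x. \<Sum>i\<in>I. f i x)"
  using assms(3,4)
proof (induction I rule: finite_induct)
  case empty
  then show ?case using assms by (simp add: hausdorff_vector_topology_def)
next
  case (insert i I)
  then show ?case by (simp add: continuous_map_vector_add[OF assms(1)])
qed

lemma hausdorff_vector_topology_euclidean:
  "hausdorff_vector_topology UNIV (euclidean :: 'a::real_tvs topology)"
  using hausdorff_vector_topology_top_of_set[of "UNIV :: 'a set"] by (simp add: subspace_UNIV)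

text \<open>The boundary of the coordinate cube has compact, hence closed image, and this image
  misses 0 by linear independence. Continuity of scaling at (0, 0) then yields a neighbourhood
  \<open>W\<close> of 0 and a \<open>\<delta>\<close> such that \<open>r *\<^sub>R w\<close> avoids
  that image for \<open>\<bar>r\<bar> < \<delta>\<close>. A vector of \<open>W\<close> with a
  coordinate larger than \<open>1 / \<delta>\<close> could be scaled onto it.\<close>

lemma representation_bounded_near_0:
  assumes T: "hausdorff_vector_topology (span B) T" and B: "finite B" "independent B"
  obtains W M where "openin T W" "0 \<in> W" "0 < M" "\<And>w b. w \<in> W \<Longrightarrow> b \<in> B \<Longrightarrow> \<bar>representation B w b\<bar> \<le> M"
proof -
  define P where "P = product_topology (\<lambda>_. top_of_set {-1..1::real}) B"
  define \<Phi> where "\<Phi> = (\<lambda>c. \<Sum>b\<in>B. c b *\<^sub>R b)"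
  \<comment> \<open>\<open>S\<close> is the boundary of the cube: all coordinates lie in [-1,1] and
    at least one is extremal.\<close>
  define S where "S = (\<Union>b\<in>B. {c \<in> topspace P. c b \<in> {-1, 1}})"
  have proj: "continuous_map P euclideanreal (\<lambda>c. c b)" if "b \<in> B" for b
    using continuous_map_product_projection[OF that, of "\<lambda>_. top_of_set {-1..1::real}"]
    by (simp add: P_def continuous_map_in_subtopology)
  have top: "topspace T = span B" and haus: "Hausdorff_space T"
    using T by (auto simp: hausdorff_vector_topology_def)
  have cont: "continuous_map P T \<Phi>"
    unfolding \<Phi>_def
    by (intro continuous_map_vector_sum[OF T] continuous_map_vector_scaleR[OF T])
       (use B top in \<open>auto simp: proj span_zero span_base\<close>)
  have "compact_space P"
    by (simp add: P_def compact_space_product_topology compact_space_subtopology compactin_euclidean_iff)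
  moreover have "closedin P S"
    unfolding S_def
    using B closedin_continuous_map_preimage[OF proj, of _ "{-1, 1}"]
    by (intro closedin_Union) auto
  ultimately have "compactin T (\<Phi> ` S)"
    using closedin_compact_space image_compactin cont by blast
  then have "closedin T (\<Phi> ` S)"
    by (simp add: compactin_imp_closedin haus)
  then have V: "openin T (span B - \<Phi> ` S)"
    by (metis openin_diff openin_topspace top)
  have rep: "representation B (\<Phi> c) b = c b" if "b \<in> B" for c b
    using B that unfolding \<Phi>_def
    by (subst representation_sum)
       (auto simp: span_base span_scale representation_scale representation_basis if_distrib sum.delta cong: if_cong)
  have \<Phi>_rep: "\<Phi> (representation B w) = w" if "w \<in> span B" for w
    unfolding \<Phi>_def using sum_representation_eq[OF B(2) that B(1) order_refl] .
  have "0 \<notin> \<Phi> ` S"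
  proof
    assume "0 \<in> \<Phi> ` S"
    then obtain c b where "\<Phi> c = 0" "b \<in> B" "c b \<in> {-1, 1}"
      by (auto simp: S_def)
    then show False
      using rep[of b c] by (auto simp: representation_zero)
  qed
  define N where "N = {z \<in> topspace (prod_topology euclideanreal T). (\<lambda>(r, x). r *\<^sub>R x) z \<in> span B - \<Phi> ` S}"
  have N: "openin (prod_topology euclideanreal T) N"
    unfolding N_def
    using openin_continuous_map_preimage[OF _ V, of "prod_topology euclideanreal T" "\<lambda>(r, x). r *\<^sub>R x"] T
    by (auto simp: hausdorff_vector_topology_def)
  have "(0, 0) \<in> N"
    using \<open>0 \<notin> \<Phi> ` S\<close> by (simp add: N_def top span_zero)
  then obtain R W where RW: "open R" "0 \<in> R" "openin T W" "0 \<in> W" "R \<times> W \<subseteq> N"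
    using N[unfolded openin_prod_topology_alt, rule_format, of 0 0] by auto
  obtain \<delta> where \<delta>: "0 < \<delta>" "\<And>r. \<bar>r\<bar> < \<delta> \<Longrightarrow> r \<in> R"
    using RW(1,2) unfolding open_dist dist_real_def by (metis diff_zero)
  have "\<bar>representation B w b\<bar> \<le> 1 / \<delta>" if w: "w \<in> W" and b: "b \<in> B" for w b
  proof (rule ccontr)
    assume big: "\<not> ?thesis"
    \<comment> \<open>Dividing by the largest absolute coordinate, rather than by the one at
      \<open>b\<close>, puts the coordinate vector of \<open>w\<close> exactly on the boundary of
      the cube.\<close>
    define m where "m = Max ((\<lambda>b. \<bar>representation B w b\<bar>) ` B)"
    have le: "\<bar>representation B w b\<bar> \<le> m" if "b \<in> B" for b
      unfolding m_def using B that by (intro Max_ge) auto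
    have "m \<in> (\<lambda>b. \<bar>representation B w b\<bar>) ` B"
      unfolding m_def using b B by (intro Max_in) auto
    then obtain b' where b': "b' \<in> B" "m = \<bar>representation B w b'\<bar>"
      by blast
    have gt: "1 / \<delta> < m" using le[OF b] big by linarith
    then have m: "0 < m"
      using \<open>0 < \<delta>\<close> by (meson less_trans zero_less_divide_1_iff)
    then have m': "\<bar>1 / m\<bar> < \<delta>"
      using \<open>0 < \<delta>\<close> gt by (simp add: field_simps)
    have "w \<in> span B" using w RW(3) openin_subset top by blast
    define c where "c = (\<lambda>b\<in>B. representation B w b / m)"
    have "\<bar>c b\<bar> \<le> 1" if "b \<in> B" for b
      using le[OF that] that m by (simp add: c_def abs_divide)
    moreover have "c \<in> extensional B"
      by (simp add: c_def)
    ultimately have "c \<in> topspace P"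
      by (auto simp: P_def PiE_iff abs_le_iff minus_le_iff)
    moreover have "\<bar>c b'\<bar> = 1"
      using b' m by (simp add: c_def abs_divide)
    then have "c b' \<in> {-1, 1}"
      by (auto simp: abs_if split: if_splits)
    ultimately have "c \<in> S"
      using b'(1) unfolding S_def by auto
    moreover have "\<Phi> c = (1 / m) *\<^sub>R \<Phi> (representation B w)"
      unfolding \<Phi>_def c_def by (simp add: scaleR_sum_right)
    then have "\<Phi> c = (1 / m) *\<^sub>R w"
      by (simp add: \<Phi>_rep \<open>w \<in> span B\<close>)
    moreover have "(1 / m, w) \<in> N"
      using RW(5) w \<delta>(2)[OF m'] by blast
    ultimately show False
      unfolding N_def by (metis (mono_tags, lifting) DiffD2 case_prod_conv image_eqI mem_Collect_eq)
  qed
  then show ?thesis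
    using that[OF RW(3,4), of "1 / \<delta>"] \<open>0 < \<delta>\<close> by auto
qed

text \<open>A linear functional bounded on a neighbourhood of 0 is continuous; no metric or norm is
  available for \<open>T\<close>, so the neighbourhood of a point is obtained by translating and
  scaling \<open>W\<close>.\<close>

lemma continuous_map_representation:
  assumes T: "hausdorff_vector_topology (span B) T" and B: "finite B" "independent B" and b: "b \<in> B"
  shows "continuous_map T euclideanreal (\<lambda>x. representation B x b)"
proof -
  have top: "topspace T = span B"
    using T by (auto simp: hausdorff_vector_topology_def)
  obtain W M where W: "openin T W" "0 \<in> W" "0 < M" and bd: "\<And>w b. w \<in> W \<Longrightarrow> b \<in> B \<Longrightarrow> \<bar>representation B w b\<bar> \<le> M"
    using representation_bounded_near_0[OF T B] by blast
  show ?thesis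
    unfolding continuous_map_def
  proof (intro conjI allI impI)
    fix V :: "real set" assume "openin euclidean V"
    then have V: "open V" by simp
    show "openin T {x \<in> topspace T. representation B x b \<in> V}"
    proof (subst openin_subopen, safe)
      fix x assume x: "x \<in> topspace T" and "representation B x b \<in> V"
      then obtain e where e: "0 < e" "\<And>y. \<bar>y - representation B x b\<bar> < e \<Longrightarrow> y \<in> V"
        using V unfolding open_dist by (metis dist_real_def)
      \<comment> \<open>On \<open>N\<close> the coordinate differs from that of \<open>x\<close> by
        at most \<open>e / 2\<close>, since it is bounded by \<open>M\<close> on \<open>W\<close>;
        the factor 2 makes the final estimate strict.\<close>
      define N where "N = {y \<in> topspace T. (2 * M / e) *\<^sub>R (y + (- x)) \<in> W}"
      have "continuous_map T T (\<lambda>y. (2 * M / e) *\<^sub>R (y + (- x)))"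
        using x top by (intro continuous_map_vector_scaleR[OF T] continuous_map_vector_add[OF T])
          (auto simp: span_neg)
      then have "openin T N"
        unfolding N_def using W(1) openin_continuous_map_preimage by blast
      moreover have "x \<in> N" using W x by (simp add: N_def)
      moreover have "N \<subseteq> {x \<in> topspace T. representation B x b \<in> V}"
      proof (safe; clarsimp simp: N_def)
        fix y assume y: "y \<in> topspace T" "(2 * M / e) *\<^sub>R (y - x) \<in> W"
        have "representation B ((2 * M / e) *\<^sub>R (y - x)) b = (2 * M / e) * (representation B y b - representation B x b)"
          using x y B top by (simp add: representation_scale representation_diff span_diff)
        then have "\<bar>(2 * M / e) * (representation B y b - representation B x b)\<bar> \<le> M"
          using bd[OF y(2) b] by simp
        then have "2 * \<bar>representation B y b - representation B x b\<bar> \<le> e"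
          using W(3) e(1) by (simp add: abs_mult pos_divide_le_eq mult.commute mult.left_commute)
        then show "representation B y b \<in> V"
          using e(1) by (intro e(2)) auto
      qed
      ultimately show "\<exists>N. openin T N \<and> x \<in> N \<and> N \<subseteq> {x \<in> topspace T. representation B x b \<in> V}"
        by blast
    qed
  qed auto
qed

text \<open>The identity is the map to the coordinates followed by the linear combination of basis
  vectors. The first is continuous for any Hausdorff vector topology on the source, the second for
  any on the target, so the identity is continuous in both directions.\<close>

lemma hausdorff_vector_topology_unique:
  assumes T: "hausdorff_vector_topology F T" "hausdorff_vector_topology F T'"
    and F: "fin_dim_subspace F"
  shows "T = T'"
proof -
  obtain B0 where "finite B0" "F = span B0"
    using F by (auto simp: fin_dim_subspace_def)
  moreover obtain B where "B \<subseteq> B0" "independent B" "B0 \<subseteq> span B"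
    by (rule maximal_independent_subset)
  ultimately have B: "finite B" "independent B" "F = span B"
    using finite_subset span_subspace[of B "span B0"] span_superset[of B0] span_minimal[of B0 "span B"]
    by auto
  have id: "continuous_map S S' (\<lambda>x. x)"
    if S: "hausdorff_vector_topology F S" and S': "hausdorff_vector_topology F S'" for S S' 
  proof -
    have "continuous_map S S' (\<lambda>x. \<Sum>b\<in>B. representation B x b *\<^sub>R b)"
      using B S S'
      by (intro continuous_map_vector_sum[OF S'] continuous_map_vector_scaleR[OF S'] continuous_map_representation)
         (auto simp: span_zero hausdorff_vector_topology_def span_base)
    then show ?thesis
      by (rule continuous_map_eq)
         (use B S in \<open>simp add: hausdorff_vector_topology_def sum_representation_eq\<close>)
  qed
  have "topspace T = topspace T'"
    using T by (simp add: hausdorff_vector_topology_def)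
  moreover have "openin T W \<longleftrightarrow> openin T' W" for W
    using id[OF T] id[OF T(2,1)] calculation topology_finer_continuous_id[of T T']
      topology_finer_continuous_id[of T' T] by (auto simp: id_def)
  ultimately show ?thesis by (simp add: topology_eq)
qed

lemma fin_dim_subspace_imp_subspace: "fin_dim_subspace F \<Longrightarrow> subspace F"
  by (auto simp: fin_dim_subspace_def)

text \<open>Unfolds the definite description once and for all: the induced topology witnesses
  existence, and uniqueness excludes any other value. From here on only subspace topologies of the
  ambient space are used.\<close>

lemma fin_dim_topology_eq:
  fixes F :: "'a::real_tvs set"
  assumes "fin_dim_subspace F"
  shows "fin_dim_topology F = top_of_set F"
  unfolding fin_dim_topology_def
proof (rule the_equality)
  show "hausdorff_vector_topology F (top_of_set F)"
    using assms by (simp add: hausdorff_vector_topology_top_of_set fin_dim_subspace_imp_subspace)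
  then show "T = top_of_set F" if "hausdorff_vector_topology F T" for T
    using that assms hausdorff_vector_topology_unique by blast
qed

lemma fin_dim_part_eq:
  fixes F :: "'a::real_tvs set"
  assumes "fin_dim_subspace F"
  shows "fin_dim_part U F = top_of_set (U \<inter> F)"
  by (simp add: fin_dim_part_def fin_dim_topology_eq assms subtopology_subtopology Int_ac)

section \<open>Compact sets in the finite topology\<close>

lemma topspace_finite_topology: "topspace (finite_topology V) = V" if "subspace V"
  for V :: "'a::real_tvs set"
proof -
  have "openin (finite_topology V) V"
    by (auto simp: openin_finite_topology fin_dim_topology_eq Int_absorb1)
  then show ?thesis
    using openin_subset[of "finite_topology V" V] openin_finite_topology[of V "topspace (finite_topology V)"]
    by auto
qed

lemma continuous_map_finite_topology_subspace:
  fixes V :: "'a::real_tvs set"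
  assumes "fin_dim_subspace F" "F \<subseteq> V" "subspace V"
  shows "continuous_map (top_of_set F) (finite_topology V) (\<lambda>x. x)"
  using assms unfolding continuous_map_def topspace_finite_topology[OF assms(3)]
  by (auto simp: openin_finite_topology fin_dim_topology_eq Int_def conj_commute)

lemma continuous_map_finite_topology_euclidean:
  fixes V :: "'a::real_tvs set"
  assumes "subspace V"
  shows "continuous_map (finite_topology V) euclidean (\<lambda>x. x)"
  unfolding continuous_map_def topspace_finite_topology[OF assms]
  by (auto simp: openin_finite_topology fin_dim_topology_eq openin_open)

text \<open>Every subset of an infinite linearly independent set is closed in the finite topology, so a
  compact set contains no such set.\<close>
lemma compactin_finite_topology_imp_fin_dim:
  fixes V :: "'a::real_tvs set"
  assumes V: "subspace V" and K: "compactin (finite_topology V) K"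
  obtains F where "fin_dim_subspace F" "F \<subseteq> V" "K \<subseteq> F"
proof -
  obtain B where B: "B \<subseteq> K" "independent B" "K \<subseteq> span B"
    by (rule maximal_independent_subset)
  have KV: "K \<subseteq> V"
    using compactin_subset_topspace[OF K] topspace_finite_topology[OF V] by simp
  have "finite B"
  proof (rule ccontr)
    assume inf: "infinite B"
    have op: "openin (finite_topology V) (V - S)" if "S \<subseteq> B" for S
      unfolding openin_finite_topology
    proof (intro conjI allI impI)
      fix F assume F: "fin_dim_subspace F \<and> F \<subseteq> V"
      then obtain C where "finite C" "F = span C"
        by (auto simp: fin_dim_subspace_def)
      moreover have "independent (S \<inter> F)"
        using B(2) that independent_mono[of B "S \<inter> F"] by blast
      ultimately have "finite (S \<inter> F)"
        using independent_span_bound[of C "S \<inter> F"] by auto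
      then have "open (- (S \<inter> F))"
        using finite_imp_closed open_Compl by blast
      moreover have "(V - S) \<inter> F = F \<inter> - (S \<inter> F)"
        using F by auto
      ultimately show "openin (fin_dim_topology F) ((V - S) \<inter> F)"
        using F by (auto simp: fin_dim_topology_eq openin_open)
    qed auto
    \<comment> \<open>Each member of this cover meets \<open>B\<close> in a single point, so
      finitely many members contain only finitely many points of \<open>B\<close>. A point outside
      \<open>B\<close> lies in every member, which is why \<open>B\<close> has to be nonempty for
      the cover to reach all of \<open>K\<close>.\<close>
    define \<U> where "\<U> = (\<lambda>b. V - (B - {b})) ` B"
    have "B \<noteq> {}" using inf by auto
    then have "K \<subseteq> \<Union>\<U>"
      using KV unfolding \<U>_def by blast
    moreover have "\<forall>W\<in>\<U>. openin (finite_topology V) W"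
      unfolding \<U>_def by (auto intro: op)
    ultimately obtain \<D> where "finite \<D>" "\<D> \<subseteq> \<U>" "K \<subseteq> \<Union>\<D>"
      using K unfolding compactin_def by blast
    then obtain C where C: "finite C" "C \<subseteq> B" "\<D> = (\<lambda>b. V - (B - {b})) ` C"
      unfolding \<U>_def using finite_subset_image[of \<D> "\<lambda>b. V - (B - {b})" B] by blast
    have "B \<subseteq> C"
    proof
      fix b assume "b \<in> B"
      then have "b \<in> \<Union>\<D>" using B(1) \<open>K \<subseteq> \<Union>\<D>\<close> by blast
      then show "b \<in> C" using C(3) \<open>b \<in> B\<close> by blast
    qed
    then show False using inf C finite_subset by blast
  qed
  moreover have "span B \<subseteq> V"
    using B(1) KV V by (intro span_minimal) auto
  ultimately show ?thesis
    using that[of "span B"] B(3) by (auto simp: fin_dim_subspace_def)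
qed

section \<open>The directed family of finite-dimensional subspaces\<close>

lemma fin_dim_subspace_span_Un:
  assumes "fin_dim_subspace F" "finite S"
  shows "fin_dim_subspace (span (F \<union> S))"
proof -
  obtain B where "finite B" "F = span B"
    using assms by (auto simp: fin_dim_subspace_def)
  then have "span (F \<union> S) = span (B \<union> S)"
    by (simp add: span_Un span_span)
  then show ?thesis
    using assms \<open>finite B\<close> unfolding fin_dim_subspace_def by blast
qed

lemma fin_dim_subspace_sum:
  assumes "fin_dim_subspace F" "fin_dim_subspace G"
  shows "fin_dim_subspace (span (F \<union> G))"
proof -
  obtain B C where "finite B" "F = span B" "finite C" "G = span C"
    using assms by (auto simp: fin_dim_subspace_def)
  then have "span (F \<union> G) = span (B \<union> C)"
    by (simp add: span_Un span_span)
  then show ?thesis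
    using \<open>finite B\<close> \<open>finite C\<close> unfolding fin_dim_subspace_def by blast
qed

lemma fin_dim_subspaces_at_directed:
  assumes V: "subspace V" and p: "p \<in> V"
  shows "directed_index (fin_dim_subspaces_at V p) (\<subseteq>)"
proof -
  have "span {p} \<in> fin_dim_subspaces_at V p"
    using assms by (auto simp: fin_dim_subspaces_at_def fin_dim_subspace_def span_base intro: span_minimal[THEN subsetD])
  moreover have "\<exists>H\<in>fin_dim_subspaces_at V p. F \<subseteq> H \<and> G \<subseteq> H"
    if "F \<in> fin_dim_subspaces_at V p" "G \<in> fin_dim_subspaces_at V p" for F G
  proof
    show "span (F \<union> G) \<in> fin_dim_subspaces_at V p"
      using that V fin_dim_subspace_sum[of F G] span_minimal[of "F \<union> G" V] span_superset[of "F \<union> G"]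
      by (auto simp: fin_dim_subspaces_at_def)
    show "F \<subseteq> span (F \<union> G) \<and> G \<subseteq> span (F \<union> G)"
      using span_superset[of "F \<union> G"] by blast
  qed
  ultimately show ?thesis
    unfolding directed_index_def by auto
qed

section \<open>Cubes: grids and collars\<close>

lemma unit_cube_topspace: "topspace (unit_cube k) = {..<k} \<rightarrow>\<^sub>E {0..1}"
  by (simp add: unit_cube_def)

lemma compact_space_unit_cube: "compact_space (unit_cube k)"
  by (simp add: unit_cube_def compact_space_product_topology compact_space_subtopology compactin_euclidean_iff)

lemma unit_cube_coordinate:
  "i < k \<Longrightarrow> continuous_map (unit_cube k) euclideanreal (\<lambda>x. x i)"
  using continuous_map_product_projection[of i "{..<k}" "\<lambda>_. top_of_set {0..1::real}"]
  by (simp add: unit_cube_def continuous_map_in_subtopology)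

lemma continuous_map_into_unit_cube:
  "continuous_map X (unit_cube k) f \<longleftrightarrow>
     f \<in> topspace X \<rightarrow> topspace (unit_cube k) \<and> (\<forall>i<k. continuous_map X euclideanreal (\<lambda>x. f x i))"
  unfolding unit_cube_def continuous_map_componentwise
  by (auto simp: continuous_map_in_subtopology PiE_iff Pi_iff image_subset_iff)

lemma cube_boundary_subset: "cube_boundary k \<subseteq> topspace (unit_cube k)"
  by (auto simp: cube_boundary_def)

text \<open>The cube is an abstract product topology without a metric, so closeness is expressed
  coordinatewise, the form in which the grid and the collar use it.\<close>

lemma unit_cube_Lebesgue_number:
  assumes fin: "finite \<U>" and op: "\<And>W. W \<in> \<U> \<Longrightarrow> openin (unit_cube k) W"
    and cover: "topspace (unit_cube k) \<subseteq> \<Union>\<U>"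
  obtains \<delta> where "0 < \<delta>"
    "\<And>x. x \<in> topspace (unit_cube k) \<Longrightarrow>
       \<exists>W\<in>\<U>. \<forall>y\<in>topspace (unit_cube k). (\<forall>i<k. \<bar>y i - x i\<bar> < \<delta>) \<longrightarrow> y \<in> W"
proof -
  define box where "box = (\<lambda>x \<epsilon>. {y \<in> topspace (unit_cube k). \<forall>i<k. \<bar>y i - x i\<bar> < (\<epsilon>::real)})"
  have box: "\<exists>\<epsilon>>0. \<exists>W\<in>\<U>. box x (2 * \<epsilon>) \<subseteq> W" if x: "x \<in> topspace (unit_cube k)" for x
  proof -
    obtain W where W: "W \<in> \<U>" "x \<in> W" using cover x by blast
    then have "openin (unit_cube k) W" using op by blast
    then obtain V where V: "\<And>i. i < k \<Longrightarrow> openin (top_of_set {0..1::real}) (V i)" "x \<in> Pi\<^sub>E {..<k} V" "Pi\<^sub>E {..<k} V \<subseteq> W"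
      using W(2) unfolding unit_cube_def openin_product_topology_alt by (auto dest!: bspec[OF _ W(2)])
    have "\<exists>e>0. \<forall>s\<in>{0..1}. \<bar>s - x i\<bar> < e \<longrightarrow> s \<in> V i" if i: "i < k" for i
    proof -
      obtain V' where "open V'" "V i = {0..1} \<inter> V'"
        using V(1)[OF i] by (auto simp: openin_open)
      moreover have "x i \<in> V i" using V(2) i by auto
      ultimately show ?thesis
        unfolding open_dist dist_real_def by fastforce
    qed
    then obtain e where e: "\<And>i. i < k \<Longrightarrow> 0 < e i" "\<And>i s. i < k \<Longrightarrow> s \<in> {0..1} \<Longrightarrow> \<bar>s - x i\<bar> < e i \<Longrightarrow> s \<in> V i"
      by metis
    \<comment> \<open>The inserted 1 keeps the minimum defined for \<open>k = 0\<close>. Halving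
      leaves room for the triangle inequality: the box of twice this radius still lies in
      \<open>W\<close>.\<close>
    define \<epsilon> where "\<epsilon> = Min (insert 1 (e ` {..<k})) / 2"
    have "0 < \<epsilon>" unfolding \<epsilon>_def using e(1) by (auto simp: Min_gr_iff)
    have le: "2 * \<epsilon> \<le> e i" if "i < k" for i
      unfolding \<epsilon>_def using that by simp
    have "y \<in> Pi\<^sub>E {..<k} V" if "y \<in> box x (2 * \<epsilon>)" for y
      unfolding PiE_iff
    proof (intro conjI ballI)
      show "y \<in> extensional {..<k}"
        using that by (auto simp: box_def unit_cube_topspace PiE_iff)
      fix i assume "i \<in> {..<k}"
      then have "i < k" "y i \<in> {0..1}" "\<bar>y i - x i\<bar> < 2 * \<epsilon>"
        using that by (auto simp: box_def unit_cube_topspace)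
      then show "y i \<in> V i"
        using e(2)[of i "y i"] le[of i] by linarith
    qed
    then have "box x (2 * \<epsilon>) \<subseteq> W"
      using V(3) by (meson subsetI subsetD)
    then show ?thesis
      using W(1) \<open>0 < \<epsilon>\<close> by (intro exI[of _ \<epsilon>] conjI bexI[of _ W])
  qed
  then have "\<forall>x\<in>topspace (unit_cube k). \<exists>\<epsilon>. 0 < \<epsilon> \<and> (\<exists>W\<in>\<U>. box x (2 * \<epsilon>) \<subseteq> W)"
    by blast
  then have "\<exists>\<epsilon>. \<forall>x\<in>topspace (unit_cube k). 0 < \<epsilon> x \<and> (\<exists>W\<in>\<U>. box x (2 * \<epsilon> x) \<subseteq> W)"
    by (rule bchoice)
  then obtain \<epsilon> where \<epsilon>: "\<And>x. x \<in> topspace (unit_cube k) \<Longrightarrow> 0 < \<epsilon> x"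
      "\<And>x. x \<in> topspace (unit_cube k) \<Longrightarrow> \<exists>W\<in>\<U>. box x (2 * \<epsilon> x) \<subseteq> W"
    by blast
  have opb: "openin (unit_cube k) (box x e)" for x e
  proof -
    have "openin (unit_cube k) (topspace (unit_cube k) \<inter> (\<Inter>i\<in>{..<k}. {y \<in> topspace (unit_cube k). y i \<in> {x i - e<..<x i + e}}))"
    proof (intro openin_Int_Inter)
      fix W assume "W \<in> (\<lambda>i. {y \<in> topspace (unit_cube k). y i \<in> {x i - e<..<x i + e}}) ` {..<k}"
      then show "openin (unit_cube k) W"
        using openin_continuous_map_preimage[OF unit_cube_coordinate, of _ k "{_<..<_}"]
        by (auto simp del: greaterThanLessThan_iff)
    qed auto
    also have "topspace (unit_cube k) \<inter> (\<Inter>i\<in>{..<k}. {y \<in> topspace (unit_cube k). y i \<in> {x i - e<..<x i + e}}) = box x e"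
      by (auto simp: box_def abs_less_iff algebra_simps)
    finally show ?thesis .
  qed
  \<comment> \<open>The boxes of radius \<open>\<epsilon> x\<close> form the cover, while the
    doubled boxes lie in members of the given family. A point within \<open>\<delta>\<close> of some
    \<open>x\<close> in the box about \<open>c\<close> is therefore still in the doubled
    box.\<close>
  have "topspace (unit_cube k) \<subseteq> \<Union>((\<lambda>x. box x (\<epsilon> x)) ` topspace (unit_cube k))"
    using \<epsilon>(1) by (auto simp: box_def)
  then obtain \<D> where "finite \<D>" "\<D> \<subseteq> (\<lambda>x. box x (\<epsilon> x)) ` topspace (unit_cube k)" "topspace (unit_cube k) \<subseteq> \<Union>\<D>"
    using compact_space_unit_cube[of k, unfolded compact_space_alt, rule_format,
        of "(\<lambda>x. box x (\<epsilon> x)) ` topspace (unit_cube k)"] opb by blast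
  then obtain C where C: "finite C" "C \<subseteq> topspace (unit_cube k)" "topspace (unit_cube k) \<subseteq> (\<Union>x\<in>C. box x (\<epsilon> x))"
    using finite_subset_image[of \<D> "\<lambda>x. box x (\<epsilon> x)" "topspace (unit_cube k)"] by blast
  define \<delta> where "\<delta> = Min (insert 1 (\<epsilon> ` C))"
  have \<delta>: "0 < \<delta>" "\<And>x. x \<in> C \<Longrightarrow> \<delta> \<le> \<epsilon> x"
    unfolding \<delta>_def using C(1,2) \<epsilon>(1) by (auto simp: Min_gr_iff)
  show thesis
  proof (rule that[OF \<delta>(1)])
    fix x assume "x \<in> topspace (unit_cube k)"
    then obtain c where c: "c \<in> C" "x \<in> box c (\<epsilon> c)" using C(3) by blast
    then obtain W where W: "W \<in> \<U>" "box c (2 * \<epsilon> c) \<subseteq> W" using \<epsilon>(2) C(2) by blast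
    have "y \<in> box c (2 * \<epsilon> c)" if "y \<in> topspace (unit_cube k)" "\<forall>i<k. \<bar>y i - x i\<bar> < \<delta>" for y
      unfolding box_def
    proof (safe intro!: that(1))
      fix i assume "i < k"
      then have "\<bar>y i - x i\<bar> < \<epsilon> c" "\<bar>x i - c i\<bar> < \<epsilon> c"
        using that(2) \<delta>(2)[OF c(1)] c(2) by (force simp: box_def)+
      then show "\<bar>y i - c i\<bar> < 2 * \<epsilon> c" by linarith
    qed
    then show "\<exists>W\<in>\<U>. \<forall>y\<in>topspace (unit_cube k). (\<forall>i<k. \<bar>y i - x i\<bar> < \<delta>) \<longrightarrow> y \<in> W"
      using W by blast
  qed
qed

section \<open>Tent functions and the partition of unity of a grid\<close>

lemma sum_tents:
  fixes s :: real
  assumes "0 \<le> s" "s \<le> real N"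
  shows "(\<Sum>j\<le>N. max 0 (1 - \<bar>s - real j\<bar>)) = 1"
  using assms
proof (induction N)
  case 0
  then show ?case by simp
next
  case (Suc N)
  show ?case
  proof (cases "s \<le> real N")
    case True
    then show ?thesis using Suc by simp
  next
    case False
    \<comment> \<open>For \<open>s\<close> between \<open>N\<close> and \<open>N + 1\<close> only
      the last two tents survive, with values \<open>1 - (s - N)\<close> and
      \<open>s - N\<close>.\<close>
    have "(\<Sum>j\<le>N. max 0 (1 - \<bar>s - real j\<bar>)) = (\<Sum>j\<le>N. if j = N then 1 - (s - real N) else 0)"
    proof (rule sum.cong)
      fix j assume "j \<in> {..N}"
      then consider "j = N" | "real j \<le> real N - 1" by force
      then show "max 0 (1 - \<bar>s - real j\<bar>) = (if j = N then 1 - (s - real N) else 0)"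
        using False Suc.prems by cases auto
    qed simp
    then show ?thesis
      using False Suc.prems by (simp add: sum.delta)
  qed
qed

lemma card_tents: "finite {j::nat. max 0 (1 - \<bar>s - real j\<bar>) \<noteq> 0} \<and> card {j::nat. max 0 (1 - \<bar>s - real j\<bar>) \<noteq> 0} \<le> 2"
proof -
  have "{j::nat. max 0 (1 - \<bar>s - real j\<bar>) \<noteq> 0} \<subseteq> {nat \<lfloor>s\<rfloor>, nat \<lfloor>s\<rfloor> + 1}" (is "?A \<subseteq> ?B")
  proof
    fix j assume "j \<in> ?A"
    then have "\<bar>s - real j\<bar> < 1" by (auto simp: max_def split: if_splits)
    then show "j \<in> ?B" by simp linarith
  qed
  then show ?thesis
    using card_mono[of ?B ?A] finite_subset[of ?A ?B] card_insert_le_m1[of 2 "{nat \<lfloor>s\<rfloor> + 1}"] by auto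
qed

text \<open>The weights are products of one-dimensional tents over the grid of mesh
  \<open>1 / N\<close> with \<open>1 / N < \<delta>\<close>. Distributing the product over the sum
  reduces the total weight to the one-dimensional identity. A nonzero weight requires a nonzero tent
  in each coordinate, with at most two choices there, so the count \<open>2 ^ k\<close> is
  independent of \<open>\<delta>\<close>.\<close>

lemma unit_cube_partition_of_unity:
  assumes "0 < \<delta>"
  obtains V :: "(nat \<Rightarrow> real) set" and w where
    "finite V" "V \<subseteq> topspace (unit_cube k)"
    "\<And>v. v \<in> V \<Longrightarrow> continuous_map (unit_cube k) euclideanreal (w v)"
    "\<And>v x. 0 \<le> w v x"
    "\<And>x. x \<in> topspace (unit_cube k) \<Longrightarrow> (\<Sum>v\<in>V. w v x) = 1"
    "\<And>v x i. \<lbrakk>v \<in> V; w v x \<noteq> 0; i < k\<rbrakk> \<Longrightarrow> \<bar>v i - x i\<bar> < \<delta>"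
    "\<And>x. x \<in> topspace (unit_cube k) \<Longrightarrow> card {v \<in> V. w v x \<noteq> 0} \<le> 2 ^ k"
proof -
  obtain N :: nat where N: "1 / \<delta> < real N" "0 < N"
    using reals_Archimedean2[of "1 / \<delta>"] assms
    by (metis less_trans of_nat_0_less_iff zero_less_divide_1_iff)
  define pt where "pt = (\<lambda>u::nat \<Rightarrow> nat. \<lambda>i\<in>{..<k}. real (u i) / real N)"
  define I where "I = {..<k} \<rightarrow>\<^sub>E {..N}"
  define tent where "tent = (\<lambda>s (j::nat). max 0 (1 - \<bar>s - real j\<bar>))"
  define w where "w = (\<lambda>v x. \<Prod>i<k. max 0 (1 - \<bar>real N * x i - real N * v i\<bar>))"
  have pt: "real N * pt u i = real (u i)" if "i < k" for u i
    using that N by (simp add: pt_def)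
  then have w_pt: "w (pt u) x = (\<Prod>i<k. tent (real N * x i) (u i))" for u x
    by (simp add: w_def tent_def)
  have inj: "inj_on pt I"
  proof (rule inj_onI)
    fix u u' assume "u \<in> I" "u' \<in> I" "pt u = pt u'"
    moreover have "u i = u' i" if "i < k" for i
      using pt[OF that] \<open>pt u = pt u'\<close> by (metis of_nat_eq_iff)
    ultimately show "u = u'"
      unfolding I_def by (intro PiE_ext) auto
  qed
  have fin: "finite I" by (simp add: I_def finite_PiE)
  show thesis
  proof (rule that[of "pt ` I" w])
    show "finite (pt ` I)" using fin by simp
    show "pt ` I \<subseteq> topspace (unit_cube k)"
    proof (rule image_subsetI)
      fix u assume "u \<in> I"
      then have "real (u i) / real N \<in> {0..1}" if "i < k" for i
        using that N by (auto simp: I_def PiE_iff)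
      then show "pt u \<in> topspace (unit_cube k)"
        by (auto simp: unit_cube_topspace pt_def PiE_iff)
    qed
    show "continuous_map (unit_cube k) euclideanreal (w v)" for v
      unfolding w_def
      by (intro continuous_map_prod continuous_map_real_max continuous_map_canonical_const continuous_map_real_abs
          continuous_map_diff continuous_map_real_mult unit_cube_coordinate) auto
    show "0 \<le> w v x" for v x by (simp add: w_def prod_nonneg)
    show "(\<Sum>v\<in>pt ` I. w v x) = 1" if x: "x \<in> topspace (unit_cube k)" for x
    proof -
      have "(\<Sum>v\<in>pt ` I. w v x) = (\<Sum>u\<in>I. \<Prod>i<k. tent (real N * x i) (u i))"
        by (simp add: sum.reindex[OF inj] w_pt)
      also have "\<dots> = (\<Prod>i<k. \<Sum>j\<le>N. tent (real N * x i) j)"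
        unfolding I_def by (rule prod_sum_PiE[symmetric]) auto
      also have "\<dots> = (\<Prod>i<k. 1)"
        unfolding tent_def using x N
        by (intro prod.cong sum_tents refl) (auto simp: unit_cube_topspace PiE_iff mult_le_cancel_left1)
      finally show ?thesis by simp
    qed
    show "\<bar>v i - x i\<bar> < \<delta>" if "w v x \<noteq> 0" "i < k" for v x i
    proof -
      have "max 0 (1 - \<bar>real N * x i - real N * v i\<bar>) \<noteq> 0"
        using that by (auto simp: w_def)
      then have "\<bar>real N * (v i - x i)\<bar> < 1"
        by (simp add: max_def algebra_simps split: if_splits)
      then have "real N * \<bar>v i - x i\<bar> < 1"
        by (simp only: abs_mult abs_of_nat)
      then have "\<bar>v i - x i\<bar> < 1 / real N"
        using N by (simp add: field_simps)
      also have "\<dots> < \<delta>" using N assms by (simp add: field_simps)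
      finally show ?thesis .
    qed
    show "card {v \<in> pt ` I. w v x \<noteq> 0} \<le> 2 ^ k" if "x \<in> topspace (unit_cube k)" for x
    proof -
      define J where "J = (\<Pi>\<^sub>E i\<in>{..<k}. {j. tent (real N * x i) j \<noteq> 0})"
      have J: "finite J" unfolding J_def tent_def using card_tents by (intro finite_PiE) auto
      have "{v \<in> pt ` I. w v x \<noteq> 0} \<subseteq> pt ` J"
        by (auto simp: w_pt I_def J_def PiE_iff)
      then have "card {v \<in> pt ` I. w v x \<noteq> 0} \<le> card J"
        using J by (meson card_image_le card_mono finite_imageI order_trans)
      also have "\<dots> = (\<Prod>i<k. card {j. tent (real N * x i) j \<noteq> 0})"
        by (simp add: J_def card_PiE)
      also have "\<dots> \<le> (\<Prod>i<k. 2)"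
        unfolding tent_def using card_tents by (intro prod_mono) auto
      finally show ?thesis by simp
    qed
  qed
qed

section \<open>The collar of the boundary\<close>

lemma continuous_map_Min_insert:
  fixes h :: "'i \<Rightarrow> 'a \<Rightarrow> real"
  assumes "finite I" "\<And>i. i \<in> I \<Longrightarrow> continuous_map X euclideanreal (h i)"
  shows "continuous_map X euclideanreal (\<lambda>x. Min (insert a ((\<lambda>i. h i x) ` I)))"
  using assms
proof (induction I rule: finite_induct)
  case empty
  then show ?case by simp
next
  case (insert i I)
  have "Min (insert a ((\<lambda>i. h i x) ` insert i I)) = min (h i x) (Min (insert a ((\<lambda>i. h i x) ` I)))" for x
    using insert.hyps by (simp add: insert_commute[of a])
  then show ?case
    using insert by (simp add: continuous_map_real_min)
qed

text \<open>A collar: \<open>c\<close> stretches the cube so that points at distance \<open>d x \<le> e\<close> from the boundary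
  land on it, and moves no boundary point.\<close>
lemma unit_cube_collar:
  assumes "0 < \<delta>"
  obtains c \<theta> where
    "continuous_map (unit_cube k) (unit_cube k) c"
    "\<And>x i. x \<in> topspace (unit_cube k) \<Longrightarrow> i < k \<Longrightarrow> \<bar>c x i - x i\<bar> < \<delta>"
    "continuous_map (unit_cube k) euclideanreal \<theta>"
    "\<And>x. x \<in> topspace (unit_cube k) \<Longrightarrow> \<theta> x \<in> {0..1}"
    "\<And>x. x \<in> topspace (unit_cube k) \<Longrightarrow> \<theta> x \<noteq> 0 \<Longrightarrow> c x \<in> cube_boundary k"
    "\<And>x. x \<in> cube_boundary k \<Longrightarrow> \<theta> x = 1 \<and> c x = x"
proof -
  \<comment> \<open>The bound \<open>1 / 4\<close> keeps the denominator \<open>1 - 2 * e' x\<close>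
    at least \<open>1 / 2\<close>; the bound \<open>\<delta> / 2\<close> makes the displacement
    smaller than \<open>\<delta>\<close>.\<close>
  define e where "e = min (\<delta> / 2) (1 / 4)"
  have e: "0 < e" "e \<le> 1 / 4" "e < \<delta>" using assms by (auto simp: e_def)
  \<comment> \<open>\<open>d x\<close> will be the distance to the nearest face. The inserted 1
    serves \<open>k = 0\<close>, where there is no face: then \<open>d x = 1\<close> exceeds
    \<open>e\<close>, so \<open>\<theta>\<close> vanishes. For points in a collar it is never the
    minimum, so a face realizes \<open>d x\<close>.\<close>
  define M where "M = (\<lambda>x::nat \<Rightarrow> real. insert 1 ((\<lambda>i. min (x i) (1 - x i)) ` {..<k}))"
  define d where "d = (\<lambda>x. Min (M x))"
  define e' where "e' = (\<lambda>x. min (d x) e)"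
  \<comment> \<open>In each coordinate this is the affine map taking the interval from
    \<open>e' x\<close> to \<open>1 - e' x\<close> onto [0,1]. Inside the collar
    \<open>e' x = d x\<close>, so the coordinate closest to a face is sent to that face.\<close>
  define c where "c = (\<lambda>x. \<lambda>i\<in>{..<k}. (x i - e' x) / (1 - 2 * e' x))"
  define \<theta> where "\<theta> = (\<lambda>x. max 0 (1 - d x / e))"
  have M: "finite (M x)" "M x \<noteq> {}" for x by (auto simp: M_def)
  have d_le: "d x \<le> x i" "d x \<le> 1 - x i" if "i < k" for x i
    using Min_le[OF M(1), of "min (x i) (1 - x i)" x] that by (auto simp: d_def M_def)
  have d_attained: "d x = 1 \<or> (\<exists>i<k. d x = min (x i) (1 - x i))" for x
  proof -
    have "d x \<in> M x" using Min_in[OF M] by (simp add: d_def)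
    then show ?thesis by (auto simp: M_def)
  qed
  have d0: "0 \<le> d x" if "x \<in> topspace (unit_cube k)" for x
    unfolding d_def Min_ge_iff[OF M] using that by (auto simp: M_def unit_cube_topspace PiE_iff)
  have e'01: "0 \<le> e' x" "e' x \<le> 1 / 4" if "x \<in> topspace (unit_cube k)" for x
    using d0[OF that] e by (auto simp: e'_def)
  have e'_le: "e' x \<le> x i" "e' x \<le> 1 - x i" if "i < k" for x i
    using d_le[OF that, of x] by (auto simp: e'_def)
  have contd: "continuous_map (unit_cube k) euclideanreal d"
    unfolding d_def M_def
    by (intro continuous_map_Min_insert continuous_map_real_min continuous_map_diff
        continuous_map_canonical_const unit_cube_coordinate) auto
  then have conte: "continuous_map (unit_cube k) euclideanreal e'"
    unfolding e'_def by (intro continuous_map_real_min continuous_map_canonical_const)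
  have ctop: "c x \<in> topspace (unit_cube k)" if x: "x \<in> topspace (unit_cube k)" for x
  proof -
    have "(x i - e' x) / (1 - 2 * e' x) \<in> {0..1}" if "i < k" for i
      using e'_le[OF that, of x] e'01[OF x] by (simp add: divide_le_eq)
    then show ?thesis by (auto simp: unit_cube_topspace c_def PiE_iff)
  qed
  show thesis
  proof (rule that)
    show "continuous_map (unit_cube k) (unit_cube k) c"
      unfolding continuous_map_into_unit_cube
    proof (intro conjI allI impI)
      show "c \<in> topspace (unit_cube k) \<rightarrow> topspace (unit_cube k)" using ctop by blast
      fix i assume "i < k"
      have "1 - 2 * e' x \<noteq> 0" if "x \<in> topspace (unit_cube k)" for x
        using e'01[OF that] by linarith
      then have "continuous_map (unit_cube k) euclideanreal (\<lambda>x. (x i - e' x) / (1 - 2 * e' x))"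
        using \<open>i < k\<close> by (intro continuous_map_real_divide continuous_map_diff continuous_map_real_mult
            continuous_map_canonical_const conte unit_cube_coordinate)
      then show "continuous_map (unit_cube k) euclideanreal (\<lambda>x. c x i)"
        using \<open>i < k\<close> by (simp add: c_def)
    qed
    show "\<bar>c x i - x i\<bar> < \<delta>" if x: "x \<in> topspace (unit_cube k)" and i: "i < k" for x i
    proof -
      define a where "a = 1 - 2 * e' x"
      have a: "0 < a" using e'01[OF x] by (simp add: a_def)
      have "c x i - x i = e' x * ((2 * x i - 1) / a)"
        using i a by (simp add: c_def a_def field_simps)
      \<comment> \<open>This holds because \<open>e' x\<close> is at most \<open>x i\<close> and at
        most \<open>1 - x i\<close>; hence no coordinate moves by more than
        \<open>e' x\<close>.\<close>
      moreover have "\<bar>(2 * x i - 1) / a\<bar> \<le> 1" (is "\<bar>?q\<bar> \<le> 1")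
        using e'_le[OF i, of x] a unfolding a_def by (simp add: abs_divide)
      then have "e' x * \<bar>?q\<bar> \<le> e' x * 1"
        using e'01(1)[OF x] by (rule mult_left_mono)
      ultimately have "\<bar>c x i - x i\<bar> \<le> e' x"
        using e'01(1)[OF x] by (simp only: abs_mult abs_of_nonneg mult_1_right)
      then show ?thesis using e by (simp add: e'_def)
    qed
    show "continuous_map (unit_cube k) euclideanreal \<theta>"
      unfolding \<theta>_def using e
      by (intro continuous_map_real_max continuous_map_real_divide continuous_map_diff
          continuous_map_canonical_const contd) auto
    show "\<theta> x \<in> {0..1}" if "x \<in> topspace (unit_cube k)" for x
      using d0[OF that] e by (simp add: \<theta>_def)
    show "c x \<in> cube_boundary k" if x: "x \<in> topspace (unit_cube k)" and "\<theta> x \<noteq> 0" for x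
    proof -
      have "d x < e"
        using that(2) e by (auto simp: \<theta>_def max_def field_simps split: if_splits)
      then have e'd: "e' x = d x" and "d x \<noteq> 1" using e by (auto simp: e'_def)
      then obtain i where i: "i < k" "d x = min (x i) (1 - x i)" using d_attained[of x] by blast
      then have "c x i = 0 \<or> c x i = 1"
        using e'd e'01[OF x] by (auto simp: c_def min_def field_simps split: if_splits)
      then show ?thesis
        using ctop[OF x] i(1) by (auto simp: cube_boundary_def)
    qed
    show "\<theta> x = 1 \<and> c x = x" if x: "x \<in> cube_boundary k" for x
    proof -
      have top: "x \<in> topspace (unit_cube k)" and "\<exists>i<k. x i = 0 \<or> x i = 1"
        using x by (auto simp: cube_boundary_def)
      then have "d x = 0" using d_le[of _ x] d0[of x] by force
      then have "e' x = 0" using e by (simp add: e'_def)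
      moreover have "x \<in> extensional {..<k}"
        using top by (auto simp: unit_cube_topspace PiE_iff)
      ultimately show ?thesis
        using \<open>d x = 0\<close> by (auto simp: \<theta>_def c_def extensional_def)
    qed
  qed
qed

section \<open>Approximation of maps on cubes\<close>

text \<open>The common consequence of the two hypotheses on \<open>U\<close> from which everything
  else is derived. The neighbourhood may depend on the number \<open>m\<close> of points: for open
  \<open>U\<close> it has to shrink as \<open>m\<close> grows if the space is not locally
  convex.\<close>

definition small_convex_hulls :: "'a::real_tvs set \<Rightarrow> bool" where
  "small_convex_hulls U \<longleftrightarrow>
     (\<forall>p\<in>U. \<forall>m. \<exists>W. openin (top_of_set U) W \<and> p \<in> W \<and>
        (\<forall>S. finite S \<and> S \<subseteq> W \<and> card S \<le> m \<longrightarrow> convex hull S \<subseteq> U))"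

lemma semi_locally_convex_imp_small_convex_hulls:
  assumes "semi_locally_convex U"
  shows "small_convex_hulls U"
  unfolding small_convex_hulls_def
proof (intro ballI allI)
  fix p m assume "p \<in> U"
  then obtain C W where CW: "convex C" "C \<subseteq> U" "openin (top_of_set U) W" "p \<in> W" "W \<subseteq> C"
    using assms by (auto simp: semi_locally_convex_def)
  have "convex hull S \<subseteq> U" if "S \<subseteq> W" for S
    using hull_minimal[of S C convex] that CW by blast
  then show "\<exists>W. openin (top_of_set U) W \<and> p \<in> W \<and> (\<forall>S. finite S \<and> S \<subseteq> W \<and> card S \<le> m \<longrightarrow> convex hull S \<subseteq> U)"
    using CW(3,4) by blast
qed

section \<open>Neighbourhoods of zero without local convexity\<close>

lemma open_scaleR_vimage:
  fixes B :: "'a::real_tvs set"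
  assumes "open B"
  shows "open ((\<lambda>w. r *\<^sub>R w) -` B)"
proof -
  have "continuous_map euclidean euclidean (\<lambda>w::'a. r *\<^sub>R w)"
    by (intro continuous_map_vector_scaleR[OF hausdorff_vector_topology_euclidean]) auto
  then show ?thesis
    using assms by (intro open_vimage) auto
qed

text \<open>Continuity at (0, 0) only handles scalars below some \<open>\<delta>\<close>. The whole
  interval [0,1] is reached by writing \<open>t *\<^sub>R w\<close> as
  \<open>(t * \<delta> / 2) *\<^sub>R ((2 / \<delta>) *\<^sub>R w)\<close> and shrinking the
  neighbourhood of vectors accordingly.\<close>

lemma tvs_nhd_scaleR:
  fixes V :: "'a::real_tvs set"
  assumes "open V" "0 \<in> V"
  obtains W where "open W" "0 \<in> W" "\<And>(t::real) w. 0 \<le> t \<Longrightarrow> t \<le> 1 \<Longrightarrow> w \<in> W \<Longrightarrow> t *\<^sub>R w \<in> V"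
proof -
  have "((\<lambda>z. fst z *\<^sub>R snd z) \<longlongrightarrow> 0) (nhds (0 :: real \<times> 'a))"
    using tendsto_scaleR_Pair[of 0 "0::'a"] by (simp add: nhds_prod[symmetric] zero_prod_def)
  then have "eventually (\<lambda>z. fst z *\<^sub>R snd z \<in> V) (nhds (0 :: real \<times> 'a))"
    using assms by (rule topological_tendstoD)
  then obtain S :: "(real \<times> 'a) set" where S: "open S" "(0, 0) \<in> S" "\<And>z. z \<in> S \<Longrightarrow> fst z *\<^sub>R snd z \<in> V"
    unfolding eventually_nhds zero_prod_def by auto
  obtain A B where AB: "open A" "open B" "(0, 0) \<in> A \<times> B" "A \<times> B \<subseteq> S"
    using open_prod_elim[OF S(1,2)] by blast
  obtain \<delta> where \<delta>: "0 < \<delta>" "\<And>r. \<bar>r\<bar> < \<delta> \<Longrightarrow> r \<in> A"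
    using AB(1,3) unfolding open_dist dist_real_def by force
  show thesis
  proof (rule that)
    show "open ((\<lambda>w. (2 / \<delta>) *\<^sub>R w) -` B)" by (rule open_scaleR_vimage[OF AB(2)])
    show "0 \<in> (\<lambda>w. (2 / \<delta>) *\<^sub>R w) -` B" using AB(3) by simp
    fix t :: real and w assume t: "0 \<le> t" "t \<le> 1" and w: "w \<in> (\<lambda>w. (2 / \<delta>) *\<^sub>R w) -` B"
    have "t * \<delta> \<le> 1 * \<delta>" using t \<delta>(1) by (intro mult_right_mono) auto
    then have "t * \<delta> / 2 \<in> A"
      using t \<delta>(1) by (intro \<delta>(2)) (simp add: abs_of_nonneg)
    then have "(t * \<delta> / 2, (2 / \<delta>) *\<^sub>R w) \<in> S" using w AB(4) by auto
    then show "t *\<^sub>R w \<in> V" using S(3) \<delta>(1) by fastforce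
  qed
qed

lemma tvs_nhd_add:
  fixes V :: "'a::real_tvs set"
  assumes "open V" "0 \<in> V"
  obtains W where "open W" "0 \<in> W" "\<And>v w. v \<in> W \<Longrightarrow> w \<in> W \<Longrightarrow> v + w \<in> V"
proof -
  have "open ((\<lambda>z::'a \<times> 'a. fst z + snd z) -` V)"
    using assms(1) by (intro open_vimage continuous_intros)
  then obtain A B where AB: "open A" "open B" "(0, 0) \<in> A \<times> B" "A \<times> B \<subseteq> (\<lambda>z. fst z + snd z) -` V"
    using open_prod_elim[of "(\<lambda>z::'a \<times> 'a. fst z + snd z) -` V" "(0, 0)"] assms(2) by auto
  show thesis
    by (rule that[of "A \<inter> B"]) (use AB in auto)
qed

text \<open>Without local convexity, only convex combinations of boundedly many vectors stay small.\<close>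
lemma tvs_nhd_combinations:
  fixes V :: "'a::real_tvs set"
  assumes "open V" "0 \<in> V"
  shows "\<exists>W. open W \<and> 0 \<in> W \<and>
    (\<forall>S t (h :: 'i \<Rightarrow> 'a). finite S \<and> card S \<le> m \<and> (\<forall>s\<in>S. 0 \<le> t s \<and> t s \<le> 1 \<and> h s \<in> W)
       \<longrightarrow> (\<Sum>s\<in>S. t s *\<^sub>R h s) \<in> V)"
  using assms
proof (induction m arbitrary: V)
  case 0
  then show ?case by (intro exI[of _ UNIV]) auto
next
  case (Suc m)
  obtain V' where V': "open V'" "0 \<in> V'" "\<And>v w. v \<in> V' \<Longrightarrow> w \<in> V' \<Longrightarrow> v + w \<in> V"
    using tvs_nhd_add[OF Suc.prems] by blast
  obtain W1 where W1: "open W1" "0 \<in> W1" "\<And>S t (h :: 'i \<Rightarrow> 'a). finite S \<Longrightarrow> card S \<le> m \<Longrightarrow>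
      (\<And>s. s \<in> S \<Longrightarrow> 0 \<le> t s \<and> t s \<le> 1 \<and> h s \<in> W1) \<Longrightarrow> (\<Sum>s\<in>S. t s *\<^sub>R h s) \<in> V'"
    using Suc.IH[OF V'(1,2)] by auto
  obtain W2 where W2: "open W2" "0 \<in> W2" "\<And>t w. 0 \<le> t \<Longrightarrow> t \<le> 1 \<Longrightarrow> w \<in> W2 \<Longrightarrow> t *\<^sub>R w \<in> V'"
    using tvs_nhd_scaleR[OF V'(1,2)] by blast
  have "(\<Sum>s\<in>S. t s *\<^sub>R h s) \<in> V"
    if S: "finite S" "card S \<le> Suc m" "\<forall>s\<in>S. 0 \<le> t s \<and> t s \<le> 1 \<and> h s \<in> W1 \<inter> W2" for S t and h :: "'i \<Rightarrow> 'a"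
  proof (cases "S = {}")
    case False
    then obtain a where a: "a \<in> S" by blast
    have "(\<Sum>s\<in>S - {a}. t s *\<^sub>R h s) \<in> V'"
      using S a by (intro W1(3)) auto
    moreover have "t a *\<^sub>R h a \<in> V'"
      using S(3) a by (intro W2(3)) auto
    ultimately show ?thesis
      using V'(3) sum.remove[OF S(1) a, of "\<lambda>s. t s *\<^sub>R h s"] by simp
  qed (use Suc.prems in simp)
  then show ?case
    using W1(1,2) W2(1,2) by (intro exI[of _ "W1 \<inter> W2"]) (simp add: open_Int)
qed

text \<open>The weights of a convex combination sum to 1, so subtracting \<open>p\<close> from the
  combination equals combining the differences \<open>x - p\<close>. These are small, and there are
  at most \<open>m\<close> of them.\<close>

lemma open_imp_small_convex_hulls:
  fixes U :: "'a::real_tvs set"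
  assumes "open U"
  shows "small_convex_hulls U"
  unfolding small_convex_hulls_def
proof (intro ballI allI)
  fix p m assume "p \<in> U"
  have "open ((\<lambda>v. p + v) -` U)"
    using assms by (intro open_vimage continuous_intros)
  then obtain W where W: "open W" "0 \<in> W"
    "\<And>S t (h :: 'a \<Rightarrow> 'a). finite S \<Longrightarrow> card S \<le> m \<Longrightarrow> (\<And>s. s \<in> S \<Longrightarrow> 0 \<le> t s \<and> t s \<le> 1 \<and> h s \<in> W) \<Longrightarrow>
       (\<Sum>s\<in>S. t s *\<^sub>R h s) \<in> (\<lambda>v. p + v) -` U"
    using tvs_nhd_combinations[of "(\<lambda>v. p + v) -` U" m, where 'i = 'a] \<open>p \<in> U\<close> by auto
  define W' where "W' = U \<inter> (\<lambda>x. x - p) -` W"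
  have "open ((\<lambda>x. x - p) -` W)"
    using W(1) by (intro open_vimage continuous_intros)
  then have "openin (top_of_set U) W'"
    by (auto simp: W'_def)
  moreover have "p \<in> W'" using \<open>p \<in> U\<close> W(2) by (simp add: W'_def)
  moreover have "convex hull S \<subseteq> U" if S: "finite S" "S \<subseteq> W'" "card S \<le> m" for S
  proof
    fix y assume "y \<in> convex hull S"
    then obtain u where u: "\<forall>x\<in>S. 0 \<le> u x" "sum u S = 1" "(\<Sum>x\<in>S. u x *\<^sub>R x) = y"
      unfolding convex_hull_finite[OF S(1)] by blast
    have "u x \<le> 1" if "x \<in> S" for x
      using member_le_sum[OF that, of u] u S(1) by auto
    then have "(\<Sum>x\<in>S. u x *\<^sub>R (x - p)) \<in> (\<lambda>v. p + v) -` U"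
      using S u by (intro W(3)) (auto simp: W'_def)
    moreover have "(\<Sum>x\<in>S. u x *\<^sub>R (x - p)) = y - p"
      using u by (simp add: scaleR_diff_right sum_subtractf scaleR_sum_left[symmetric])
    ultimately show "y \<in> U" by simp
  qed
  ultimately show "\<exists>W. openin (top_of_set U) W \<and> p \<in> W \<and> (\<forall>S. finite S \<and> S \<subseteq> W \<and> card S \<le> m \<longrightarrow> convex hull S \<subseteq> U)"
    by blast
qed

section \<open>Approximation relative to the boundary\<close>

lemma finite_hull_cover:
  assumes hulls: "small_convex_hulls U" and f: "continuous_map X (top_of_set U) f" and "compact_space X"
  obtains \<W> where "finite \<W>" "\<And>W. W \<in> \<W> \<Longrightarrow> openin (top_of_set U) W" "f ` topspace X \<subseteq> \<Union>\<W>"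
    "\<And>W S. \<lbrakk>W \<in> \<W>; finite S; S \<subseteq> W; card S \<le> m\<rbrakk> \<Longrightarrow> convex hull S \<subseteq> U"
proof -
  define \<G> where "\<G> = {W. openin (top_of_set U) W \<and> (\<forall>S. finite S \<and> S \<subseteq> W \<and> card S \<le> m \<longrightarrow> convex hull S \<subseteq> U)}"
  have "compactin (top_of_set U) (f ` topspace X)"
    using assms by (simp add: compact_space_def image_compactin)
  moreover have "f ` topspace X \<subseteq> \<Union>\<G>"
  proof
    fix p assume "p \<in> f ` topspace X"
    then have "p \<in> U" using f by (auto simp: continuous_map_def)
    then show "p \<in> \<Union>\<G>" using hulls unfolding small_convex_hulls_def \<G>_def by blast
  qed
  moreover have "\<forall>W\<in>\<G>. openin (top_of_set U) W" by (simp add: \<G>_def)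
  \<comment> \<open>Finiteness of the cover is used for the Lebesgue number and again for the choice
    of nearby points of the dense subspace, where intersections of members must be open.\<close>
  ultimately obtain \<W> where "finite \<W>" "\<W> \<subseteq> \<G>" "f ` topspace X \<subseteq> \<Union>\<W>"
    unfolding compactin_def by blast
  then show thesis
    by (intro that[of \<W>]) (auto simp: \<G>_def)
qed

text \<open>The homotopy \<open>h\<close> is the straight line from \<open>f\<close> to the
  approximation \<open>g\<close>. Carrying the given \<open>F\<close> along, instead of just a base
  point, is what allows the lemma to be applied to homotopies, whose boundary values fill more than
  one point.\<close>

lemma approximate_cube_map:
  fixes U E :: "'a::real_tvs set"
  assumes hulls: "small_convex_hulls U" and E: "subspace E" and dense: "U \<subseteq> closure (U \<inter> E)"
    and f: "continuous_map (unit_cube k) (top_of_set U) f"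
    and F: "fin_dim_subspace F" "F \<subseteq> E" "f ` cube_boundary k \<subseteq> F"
  obtains G h where "fin_dim_subspace G" "F \<subseteq> G" "G \<subseteq> E"
    "continuous_map (prod_topology (top_of_set {0..1}) (unit_cube k)) (top_of_set U) h"
    "\<And>x. h (0::real, x) = f x"
    "\<And>x. x \<in> topspace (unit_cube k) \<Longrightarrow> h (1, x) \<in> G"
    "\<And>t x. x \<in> cube_boundary k \<Longrightarrow> h (t, x) = f x"
proof -
  define X where "X = topspace (unit_cube k)"
  have fU: "f x \<in> U" if "x \<in> X" for x
    using f that by (auto simp: continuous_map_def X_def)
  obtain \<W> where \<W>: "finite \<W>" "\<And>W. W \<in> \<W> \<Longrightarrow> openin (top_of_set U) W" "f ` X \<subseteq> \<Union>\<W>"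
    and hull: "\<And>W S. \<lbrakk>W \<in> \<W>; finite S; S \<subseteq> W; card S \<le> 2 ^ k + 2\<rbrakk> \<Longrightarrow> convex hull S \<subseteq> U"
    unfolding X_def using finite_hull_cover[OF hulls f compact_space_unit_cube, of "2 ^ k + 2"] by blast
  define \<U> where "\<U> = (\<lambda>W. {x \<in> X. f x \<in> W}) ` \<W>"
  have "finite \<U>" using \<W>(1) by (simp add: \<U>_def)
  moreover have "openin (unit_cube k) O'" if "O' \<in> \<U>" for O'
    using that \<W>(2) openin_continuous_map_preimage[OF f] by (auto simp: \<U>_def X_def)
  moreover have "X \<subseteq> \<Union>\<U>" using \<W>(3) by (auto simp: \<U>_def)
  ultimately obtain \<delta> where \<delta>: "0 < \<delta>"
    and leb: "\<And>x. x \<in> X \<Longrightarrow> \<exists>O'\<in>\<U>. \<forall>y\<in>X. (\<forall>i<k. \<bar>y i - x i\<bar> < \<delta>) \<longrightarrow> y \<in> O'"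
    unfolding X_def using unit_cube_Lebesgue_number[of \<U> k] by blast
  obtain V :: "(nat \<Rightarrow> real) set" and w where V: "finite V" "V \<subseteq> X"
    and w: "\<And>v. v \<in> V \<Longrightarrow> continuous_map (unit_cube k) euclideanreal (w v)" "\<And>v x. 0 \<le> w v x"
      "\<And>x. x \<in> X \<Longrightarrow> (\<Sum>v\<in>V. w v x) = 1"
      "\<And>v x i. \<lbrakk>v \<in> V; w v x \<noteq> 0; i < k\<rbrakk> \<Longrightarrow> \<bar>v i - x i\<bar> < \<delta>"
      "\<And>x. x \<in> X \<Longrightarrow> card {v \<in> V. w v x \<noteq> 0} \<le> 2 ^ k"
    unfolding X_def using unit_cube_partition_of_unity[OF \<delta>, of k] by blast
  obtain c \<theta> where c: "continuous_map (unit_cube k) (unit_cube k) c"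
      "\<And>x i. x \<in> X \<Longrightarrow> i < k \<Longrightarrow> \<bar>c x i - x i\<bar> < \<delta>"
    and \<theta>: "continuous_map (unit_cube k) euclideanreal \<theta>" "\<And>x. x \<in> X \<Longrightarrow> \<theta> x \<in> {0..1}"
    and c\<theta>: "\<And>x. x \<in> X \<Longrightarrow> \<theta> x \<noteq> 0 \<Longrightarrow> c x \<in> cube_boundary k"
      "\<And>x. x \<in> cube_boundary k \<Longrightarrow> \<theta> x = 1 \<and> c x = x"
    unfolding X_def using unit_cube_collar[OF \<delta>, of k] by blast
  \<comment> \<open>\<open>y v\<close> is put into all members containing \<open>f v\<close> at
    once, since the member that serves a point \<open>x\<close> is selected only later and varies
    with \<open>x\<close>. The finite intersection is relatively open, so density applies.\<close>
  have "\<exists>y. y \<in> U \<inter> E \<and> (\<forall>W\<in>\<W>. f v \<in> W \<longrightarrow> y \<in> W)" if v: "v \<in> V" for v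
  proof -
    have "openin (top_of_set U) (U \<inter> \<Inter>{W \<in> \<W>. f v \<in> W})"
      using \<W>(1,2) openin_Int_Inter[of "{W \<in> \<W>. f v \<in> W}" "top_of_set U" U] by auto
    then obtain Q where Q: "open Q" "U \<inter> \<Inter>{W \<in> \<W>. f v \<in> W} = U \<inter> Q"
      unfolding openin_open by blast
    have "f v \<in> U" using fU v V(2) by blast
    then have "f v \<in> Q" "f v \<in> closure (U \<inter> E)" using Q(2) dense by blast+
    then obtain y where "y \<in> Q" "y \<in> U \<inter> E"
      using open_Int_closure_eq_empty[OF Q(1), of "U \<inter> E"] by blast
    then show ?thesis using Q(2) by blast
  qed
  then have "\<exists>y. \<forall>v\<in>V. y v \<in> U \<inter> E \<and> (\<forall>W\<in>\<W>. f v \<in> W \<longrightarrow> y v \<in> W)"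
    by (intro bchoice) blast
  then obtain y where y: "\<And>v. v \<in> V \<Longrightarrow> y v \<in> E" "\<And>v W. v \<in> V \<Longrightarrow> W \<in> \<W> \<Longrightarrow> f v \<in> W \<Longrightarrow> y v \<in> W"
    by blast
  define g where "g = (\<lambda>x. \<theta> x *\<^sub>R f (c x) + (1 - \<theta> x) *\<^sub>R (\<Sum>v\<in>V. w v x *\<^sub>R y v))"
  define h where "h = (\<lambda>z. (1 - fst z) *\<^sub>R f (snd z) + fst z *\<^sub>R g (snd z))"
  define G where "G = span (F \<union> y ` V)"
  have FG: "F \<subseteq> G" unfolding G_def using span_superset by blast
  have subG: "subspace G" by (simp add: G_def)
  have yG: "y v \<in> G" if "v \<in> V" for v
    unfolding G_def using that by (intro span_base) auto
  have h_U: "h (t, x) \<in> U" if t: "t \<in> {0..1}" and x: "x \<in> X" for t x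
  proof -
    obtain O' where O': "O' \<in> \<U>" "\<And>z. z \<in> X \<Longrightarrow> (\<And>i. i < k \<Longrightarrow> \<bar>z i - x i\<bar> < \<delta>) \<Longrightarrow> z \<in> O'"
      using leb[OF x] by blast
    then obtain W where W: "W \<in> \<W>" "O' = {x \<in> X. f x \<in> W}" by (auto simp: \<U>_def)
    \<comment> \<open>A single \<open>W\<close> serves all vectors entering \<open>g x\<close>:
      \<open>x\<close>, \<open>c x\<close> and the grid points with nonzero weight at
      \<open>x\<close> are within \<open>\<delta>\<close> of \<open>x\<close> in every
      coordinate.\<close>
    have near: "f z \<in> W" if "z \<in> X" "\<And>i. i < k \<Longrightarrow> \<bar>z i - x i\<bar> < \<delta>" for z
      using O'(2)[OF that] W(2) by blast
    define V' where "V' = {v \<in> V. w v x \<noteq> 0}"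
    define S where "S = insert (f x) ((if \<theta> x = 0 then {} else {f (c x)}) \<union> y ` V')"
    have V': "finite V'" "V' \<subseteq> V" "card V' \<le> 2 ^ k" using V(1) w(5)[OF x] by (auto simp: V'_def)
    have "finite S" using V' by (simp add: S_def)
    moreover have "S \<subseteq> W"
    proof -
      have "f x \<in> W" using near[OF x] \<delta> by simp
      moreover have "c x \<in> X" using c(1) x by (auto simp: continuous_map_def X_def)
      then have "f (c x) \<in> W" using near c(2)[OF x] by blast
      moreover have "y v \<in> W" if "v \<in> V'" for v
        using that y(2)[of v W] W(1) near[of v] w(4)[of v x] V(2) by (auto simp: V'_def)
      ultimately show ?thesis by (auto simp: S_def)
    qed
    moreover have "card S \<le> 2 ^ k + 2"
    proof -
      have "S \<subseteq> {f x, f (c x)} \<union> y ` V'" by (auto simp: S_def)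
      then have "card S \<le> card ({f x, f (c x)} \<union> y ` V')" using V' by (intro card_mono) auto
      also have "\<dots> \<le> card {f x, f (c x)} + card (y ` V')" by (rule card_Un_le)
      also have "\<dots> \<le> 2 + 2 ^ k"
        using card_image_le[OF V'(1), of y] V'(3) by (intro add_mono) (auto simp: card_insert_if)
      finally show ?thesis by simp
    qed
    ultimately have sub: "convex hull S \<subseteq> U" using hull[OF W(1)] by blast
    have Q: "(\<Sum>v\<in>V. w v x *\<^sub>R y v) \<in> convex hull S"
    proof -
      have "(\<Sum>v\<in>V'. w v x) = (\<Sum>v\<in>V. w v x)"
        using V(1) by (intro sum.mono_neutral_left) (auto simp: V'_def)
      then have "(\<Sum>v\<in>V'. w v x *\<^sub>R y v) \<in> convex hull S"
        using V'(1) w(2) w(3)[OF x] by (intro convex_sum) (auto simp: S_def hull_inc convex_convex_hull)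
      moreover have "(\<Sum>v\<in>V'. w v x *\<^sub>R y v) = (\<Sum>v\<in>V. w v x *\<^sub>R y v)"
        using V(1) by (intro sum.mono_neutral_left) (auto simp: V'_def)
      ultimately show ?thesis by simp
    qed
    have "g x \<in> convex hull S"
    proof (cases "\<theta> x = 0")
      case True
      then show ?thesis using Q by (simp add: g_def)
    next
      case False
      then have "f (c x) \<in> convex hull S" by (intro hull_inc) (simp add: S_def)
      then show ?thesis
        unfolding g_def using Q \<theta>(2)[OF x] by (intro convexD[OF convex_convex_hull]) auto
    qed
    moreover have "f x \<in> convex hull S" by (intro hull_inc) (simp add: S_def)
    ultimately have "h (t, x) \<in> convex hull S"
      unfolding h_def using t by (auto intro!: convexD[OF convex_convex_hull])
    then show ?thesis using sub by blast
  qed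
  have contf: "continuous_map (unit_cube k) euclidean f"
    using f by (simp add: continuous_map_in_subtopology)
  note tvs = hausdorff_vector_topology_euclidean[where 'a = 'a]
  have contfc: "continuous_map (unit_cube k) euclidean (\<lambda>x. f (c x))"
    using continuous_map_compose[OF c(1) contf] by (simp add: o_def)
  have contg: "continuous_map (unit_cube k) euclidean g"
    unfolding g_def
    by (intro continuous_map_vector_add[OF tvs] continuous_map_vector_scaleR[OF tvs] continuous_map_vector_sum[OF tvs]
        continuous_map_diff continuous_map_canonical_const \<theta>(1) contfc w(1) V(1)) auto
  let ?Z = "prod_topology (top_of_set {0..1::real}) (unit_cube k)"
  have "continuous_map ?Z euclideanreal fst"
    using continuous_map_fst[of "top_of_set {0..1::real}" "unit_cube k"]
    by (simp add: continuous_map_in_subtopology)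
  moreover have "continuous_map ?Z euclidean (\<lambda>z. f (snd z))" "continuous_map ?Z euclidean (\<lambda>z. g (snd z))"
    using continuous_map_compose[OF continuous_map_snd contf] continuous_map_compose[OF continuous_map_snd contg]
    by (simp_all add: o_def)
  ultimately have "continuous_map ?Z euclidean h"
    unfolding h_def
    by (intro continuous_map_vector_add[OF tvs] continuous_map_vector_scaleR[OF tvs]
        continuous_map_diff continuous_map_canonical_const)
  moreover have "h ` topspace (prod_topology (top_of_set {0..1}) (unit_cube k)) \<subseteq> U"
    using h_U by (auto simp: X_def)
  ultimately have conth: "continuous_map (prod_topology (top_of_set {0..1}) (unit_cube k)) (top_of_set U) h"
    by (simp add: continuous_map_in_subtopology image_subset_iff_funcset)
  show thesis
  proof (rule that)
    show "fin_dim_subspace G" unfolding G_def using F(1) V(1) by (intro fin_dim_subspace_span_Un) auto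
    show "F \<subseteq> G" by (rule FG)
    show "G \<subseteq> E" unfolding G_def using F(2) y(1) E by (intro span_minimal) auto
    show "h (0, x) = f x" for x by (simp add: h_def)
    show "h (1, x) \<in> G" if "x \<in> topspace (unit_cube k)" for x
    proof -
      \<comment> \<open>Either the coefficient vanishes or \<open>c x\<close> lies on the boundary,
        where the values of \<open>f\<close> are in \<open>F\<close>.\<close>
      have "\<theta> x *\<^sub>R f (c x) \<in> G"
      proof (cases "\<theta> x = 0")
        case False
        then show ?thesis
          using c\<theta>(1)[of x] that F(3) FG subG by (intro subspace_scale) (auto simp: X_def)
      qed (simp add: subspace_0[OF subG])
      moreover have "(\<Sum>v\<in>V. w v x *\<^sub>R y v) \<in> G"
        using subG yG by (intro subspace_sum subspace_scale) auto
      ultimately show ?thesis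
        using subG by (simp add: h_def g_def subspace_add subspace_scale)
    qed
    show "h (t, x) = f x" if "x \<in> cube_boundary k" for t x
      using c\<theta>(2)[OF that] by (simp add: h_def g_def scaleR_left_distrib[symmetric])
  qed (rule conth)
qed

section \<open>Homotopy groups\<close>

text \<open>\<open>cube_homotopic\<close> relates only members of \<open>cube_maps\<close>, so the
  class of any other function is empty; equality of classes therefore amounts to homotopy only when
  a representative is known to be a cube map.\<close>

definition cube_class :: "nat \<Rightarrow> 'a topology \<Rightarrow> 'a \<Rightarrow> ((nat \<Rightarrow> real) \<Rightarrow> 'a) \<Rightarrow> ((nat \<Rightarrow> real) \<Rightarrow> 'a) set" where
  "cube_class k X p f = {g. cube_homotopic k X p f g}"

lemma cube_homotopicI:
  assumes "continuous_map (prod_topology (top_of_set {0..1}) (unit_cube k)) X h"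
    and "\<And>x. h (0::real, x) = f x" "\<And>x. h (1, x) = g x"
    and "\<And>t x. t \<in> {0..1} \<Longrightarrow> x \<in> cube_boundary k \<Longrightarrow> h (t, x) = p"
  shows "cube_homotopic k X p f g"
  unfolding cube_homotopic_def homotopic_with_def
  by (rule exI[of _ h]) (use assms in auto)

lemma cube_homotopicE:
  assumes "cube_homotopic k X p f g"
  obtains h where "continuous_map (prod_topology (top_of_set {0..1}) (unit_cube k)) X h"
    "\<And>x. h (0::real, x) = f x" "\<And>x. h (1, x) = g x"
    "\<And>t x. t \<in> {0..1} \<Longrightarrow> x \<in> cube_boundary k \<Longrightarrow> h (t, x) = p"
  using assms unfolding cube_homotopic_def homotopic_with_def by (auto simp: image_subset_iff)

text \<open>Reflexivity characterizes cube maps. Statements that a construction preserves cube maps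
  can thus be read off from its compatibility with homotopies by taking both sides equal.\<close>

lemma cube_homotopic_refl: "cube_homotopic k X p f f \<longleftrightarrow> f \<in> cube_maps k X p"
  by (auto simp: cube_homotopic_def cube_maps_def)

lemma cube_homotopic_sym: "cube_homotopic k X p f g \<Longrightarrow> cube_homotopic k X p g f"
  unfolding cube_homotopic_def by (rule homotopic_with_symD)

lemma cube_homotopic_trans:
  "cube_homotopic k X p f g \<Longrightarrow> cube_homotopic k X p g h \<Longrightarrow> cube_homotopic k X p f h"
  unfolding cube_homotopic_def by (rule homotopic_with_trans)

lemma cube_homotopic_imp_cube_maps:
  assumes "cube_homotopic k X p f g"
  shows "f \<in> cube_maps k X p" "g \<in> cube_maps k X p"
  using cube_homotopic_trans[OF assms cube_homotopic_sym[OF assms]]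
    cube_homotopic_trans[OF cube_homotopic_sym[OF assms] assms]
  by (simp_all add: cube_homotopic_refl)

text \<open>A homotopy must match its end maps at every argument, including those outside the cube,
  where the values are meaningless. This lemma bridges maps that agree on the cube only.\<close>

lemma cube_homotopic_eq_on:
  assumes "f \<in> cube_maps k X p" "\<And>x. x \<in> topspace (unit_cube k) \<Longrightarrow> f x = g x"
  shows "cube_homotopic k X p f g"
  unfolding cube_homotopic_def
  using assms cube_boundary_subset[of k]
  by (intro homotopic_with_equal) (auto simp: cube_maps_def image_subset_iff subset_iff)

lemma homotopy_set_eq: "homotopy_set k X p = cube_class k X p ` cube_maps k X p"
  by (simp add: homotopy_set_def quotient_def cube_class_def Image_singleton UNION_singleton_eq_range)

lemma cube_class_eq_iff:
  assumes "f \<in> cube_maps k X p"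
  shows "cube_class k X p f = cube_class k X p g \<longleftrightarrow> cube_homotopic k X p f g"
proof
  assume "cube_class k X p f = cube_class k X p g"
  moreover have "f \<in> cube_class k X p f"
    using assms cube_homotopic_refl[of k X p f] by (simp add: cube_class_def)
  ultimately show "cube_homotopic k X p f g"
    by (simp add: cube_class_def cube_homotopic_sym)
next
  assume fg: "cube_homotopic k X p f g"
  show "cube_class k X p f = cube_class k X p g"
    unfolding cube_class_def
    using cube_homotopic_trans[OF fg] cube_homotopic_trans[OF cube_homotopic_sym[OF fg]] by (intro Collect_cong iffI)
qed

lemma cube_homotopic_compose:
  assumes "cube_homotopic k X p f g" "continuous_map X Y j" "j p = q"
  shows "cube_homotopic k Y q (j \<circ> f) (j \<circ> g)"
proof -
  obtain h where h: "continuous_map (prod_topology (top_of_set {0..1}) (unit_cube k)) X h"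
    "\<And>x. h (0::real, x) = f x" "\<And>x. h (1, x) = g x"
    "\<And>t x. t \<in> {0..1} \<Longrightarrow> x \<in> cube_boundary k \<Longrightarrow> h (t, x) = p"
    using cube_homotopicE[OF assms(1)] by blast
  show ?thesis
    by (rule cube_homotopicI[OF continuous_map_compose[OF h(1) assms(2)]]) (simp_all add: h(2-4) assms(3))
qed

lemma cube_maps_compose:
  assumes "f \<in> cube_maps k X p" "continuous_map X Y j" "j p = q"
  shows "j \<circ> f \<in> cube_maps k Y q"
  using cube_homotopic_compose[of k X p f f Y j q] assms by (simp add: cube_homotopic_refl)

lemma homotopy_map_cube_class:
  assumes "f \<in> cube_maps k X p" "continuous_map X Y j" "j p = q"
  shows "homotopy_map k Y q j (cube_class k X p f) = cube_class k Y q (j \<circ> f)"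
proof (intro equalityI subsetI)
  fix h assume "h \<in> homotopy_map k Y q j (cube_class k X p f)"
  then obtain g where "cube_homotopic k X p f g" and g: "cube_homotopic k Y q (j \<circ> g) h"
    unfolding homotopy_map_def cube_class_def by blast
  then show "h \<in> cube_class k Y q (j \<circ> f)"
    unfolding cube_class_def using cube_homotopic_trans[OF cube_homotopic_compose[OF _ assms(2,3)] g] by simp
next
  fix h assume "h \<in> cube_class k Y q (j \<circ> f)"
  then show "h \<in> homotopy_map k Y q j (cube_class k X p f)"
    using assms(1) cube_homotopic_refl[of k X p f] unfolding homotopy_map_def cube_class_def by blast
qed

section \<open>Changes of the first coordinate and the group structure\<close>

lemma cube_first_coordinate:
  assumes "k \<ge> 1" "x \<in> topspace (unit_cube k)" "s \<in> {0..1}"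
  shows "x(0 := s) \<in> topspace (unit_cube k)"
  using assms by (auto simp: unit_cube_topspace PiE_iff extensional_def)

lemma cube_first_coordinate_boundary:
  assumes "k \<ge> 1" "x \<in> cube_boundary k" "s \<in> {0..1}" "x 0 \<in> {0, 1} \<Longrightarrow> s \<in> {0, 1}"
  shows "x(0 := s) \<in> cube_boundary k"
proof -
  have x: "x \<in> topspace (unit_cube k)" using assms(2) cube_boundary_subset by blast
  obtain i where i: "i < k" "x i = 0 \<or> x i = 1"
    using assms(2) by (auto simp: cube_boundary_def)
  then have "(x(0 := s)) i = 0 \<or> (x(0 := s)) i = 1"
    using assms(4) by (cases "i = 0") auto
  then show ?thesis
    using cube_first_coordinate[OF assms(1) x assms(3)] i(1) unfolding cube_boundary_def by blast
qed

lemma cube_first_coordinate_endpoint: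
  assumes "k \<ge> 1" "x \<in> topspace (unit_cube k)" "s \<in> {0, 1}"
  shows "x(0 := s) \<in> cube_boundary k"
proof -
  have "(x(0 := s)) 0 = 0 \<or> (x(0 := s)) 0 = 1" "0 < k" using assms(1,3) by auto
  moreover have "x(0 := s) \<in> topspace (unit_cube k)"
    using assms by (intro cube_first_coordinate) auto
  ultimately show ?thesis
    unfolding cube_boundary_def by blast
qed

lemma continuous_map_cube_first_coordinate:
  assumes k: "k \<ge> 1" and x: "continuous_map Z (unit_cube k) \<xi>"
    and s: "continuous_map Z euclideanreal \<sigma>" "\<And>z. z \<in> topspace Z \<Longrightarrow> \<sigma> z \<in> {0..1}"
  shows "continuous_map Z (unit_cube k) (\<lambda>z. (\<xi> z)(0 := \<sigma> z))"
  unfolding continuous_map_into_unit_cube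
proof (intro conjI allI impI)
  show "(\<lambda>z. (\<xi> z)(0 := \<sigma> z)) \<in> topspace Z \<rightarrow> topspace (unit_cube k)"
    using cube_first_coordinate[OF k] x s(2) by (auto simp: continuous_map_def)
  show "continuous_map Z euclideanreal (\<lambda>z. ((\<xi> z)(0 := \<sigma> z)) i)" if "i < k" for i
    using that x s(1) by (cases "i = 0") (simp_all add: continuous_map_into_unit_cube)
qed

text \<open>Linear interpolation between \<open>\<phi>\<close> and \<open>\<psi>\<close> stays in
  [0,1] and is constant at the two ends, where both take the same value 0 or 1; so boundary points
  remain on the boundary. The two ends may have the same image, as needed for inverses. All
  homotopies in the group axioms are of this kind, up to equality on the cube.\<close>

lemma cube_homotopic_reparametrize:
  fixes \<phi> \<psi> :: "real \<Rightarrow> real"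
  assumes k: "k \<ge> 1" and f: "f \<in> cube_maps k X p"
    and \<phi>: "continuous_on UNIV \<phi>" "\<And>s. s \<in> {0..1} \<Longrightarrow> \<phi> s \<in> {0..1}"
    and \<psi>: "continuous_on UNIV \<psi>" "\<And>s. s \<in> {0..1} \<Longrightarrow> \<psi> s \<in> {0..1}"
    and ends: "\<phi> 0 = \<psi> 0" "\<phi> 1 = \<psi> 1" "\<phi> 0 \<in> {0, 1}" "\<phi> 1 \<in> {0, 1}"
  shows "cube_homotopic k X p (\<lambda>x. f (x(0 := \<phi> (x 0)))) (\<lambda>x. f (x(0 := \<psi> (x 0))))"
proof -
  define \<sigma> where "\<sigma> = (\<lambda>z::real \<times> (nat \<Rightarrow> real). (1 - fst z) * \<phi> (snd z 0) + fst z * \<psi> (snd z 0))"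
  let ?Z = "prod_topology (top_of_set {0..1::real}) (unit_cube k)"
  have fst: "continuous_map ?Z euclideanreal fst"
    using continuous_map_fst[of "top_of_set {0..1::real}" "unit_cube k"]
    by (simp add: continuous_map_in_subtopology)
  have snd0: "continuous_map ?Z euclideanreal (\<lambda>z. snd z 0)"
    using continuous_map_compose[OF continuous_map_snd unit_cube_coordinate, of 0 k] k by (simp add: o_def)
  have comp: "continuous_map ?Z euclideanreal (\<lambda>z. \<omega> (snd z 0))" if "continuous_on UNIV \<omega>" for \<omega> :: "real \<Rightarrow> real"
    using continuous_map_compose[OF snd0, of euclideanreal \<omega>] that by (simp add: o_def)
  have cont\<sigma>: "continuous_map ?Z euclideanreal \<sigma>"
    unfolding \<sigma>_def
    by (intro continuous_map_add continuous_map_real_mult continuous_map_diff continuous_map_canonical_const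
        comp \<phi>(1) \<psi>(1) fst)
  have \<sigma>01: "\<sigma> (t, x) \<in> {0..1}" if "t \<in> {0..1}" "x 0 \<in> {0..1}" for t x
    using convexD[OF convex_closed_interval[of 0 "1::real"] \<phi>(2)[OF that(2)] \<psi>(2)[OF that(2)], of "1 - t" t] that(1)
    by (simp add: \<sigma>_def)
  have x01: "x 0 \<in> {0..1}" if "x \<in> topspace (unit_cube k)" for x
    using that k by (auto simp: unit_cube_topspace PiE_iff)
  have contf: "continuous_map (unit_cube k) X f" and fp: "\<And>x. x \<in> cube_boundary k \<Longrightarrow> f x = p"
    using f by (auto simp: cube_maps_def)
  have "continuous_map ?Z (unit_cube k) (\<lambda>z. (snd z)(0 := \<sigma> z))"
    using \<sigma>01 x01 by (intro continuous_map_cube_first_coordinate[OF k continuous_map_snd cont\<sigma>]) auto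
  from continuous_map_compose[OF this contf] show ?thesis
  proof (rule cube_homotopicI)
    fix t x assume t: "t \<in> {0..1::real}" and x: "x \<in> cube_boundary k"
    have "x 0 \<in> {0..1}" using x x01 cube_boundary_subset by blast
    moreover have "\<sigma> (t, x) \<in> {0, 1}" if "x 0 \<in> {0, 1}"
    proof -
      have "\<sigma> (t, x) = \<phi> (x 0)"
        using that ends by (auto simp: \<sigma>_def algebra_simps)
      then show ?thesis using that ends by auto
    qed
    ultimately have "x(0 := \<sigma> (t, x)) \<in> cube_boundary k"
      using \<sigma>01 t by (intro cube_first_coordinate_boundary[OF k x]) auto
    then show "(f \<circ> (\<lambda>z. (snd z)(0 := \<sigma> z))) (t, x) = p" by (simp add: fp)
  qed (simp_all add: \<sigma>_def)
qed

lemma cube_maps_reparametrize: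
  fixes \<phi> :: "real \<Rightarrow> real"
  assumes "k \<ge> 1" "f \<in> cube_maps k X p" "continuous_on UNIV \<phi>" "\<And>s. s \<in> {0..1} \<Longrightarrow> \<phi> s \<in> {0..1}"
    "\<phi> 0 \<in> {0, 1}" "\<phi> 1 \<in> {0, 1}"
  shows "(\<lambda>x. f (x(0 := \<phi> (x 0)))) \<in> cube_maps k X p"
  using cube_homotopic_reparametrize[of k f X p \<phi> \<phi>] assms by (simp add: cube_homotopic_refl)

lemma cube_homotopic_concat:
  assumes k: "k \<ge> 1" and "cube_homotopic k X p f f'" "cube_homotopic k X p g g'"
  shows "cube_homotopic k X p (cube_concat f g) (cube_concat f' g')"
proof -
  let ?Z = "prod_topology (top_of_set {0..1::real}) (unit_cube k)"
  obtain F where F: "continuous_map ?Z X F" "\<And>x. F (0::real, x) = f x" "\<And>x. F (1, x) = f' x"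
    "\<And>t x. t \<in> {0..1} \<Longrightarrow> x \<in> cube_boundary k \<Longrightarrow> F (t, x) = p"
    using cube_homotopicE[OF assms(2)] by blast
  obtain G where G: "continuous_map ?Z X G" "\<And>x. G (0::real, x) = g x" "\<And>x. G (1, x) = g' x"
    "\<And>t x. t \<in> {0..1} \<Longrightarrow> x \<in> cube_boundary k \<Longrightarrow> G (t, x) = p"
    using cube_homotopicE[OF assms(3)] by blast
  \<comment> \<open>Clamping makes both maps continuous into the cube on all of \<open>?Z\<close>;
    each clamp is inactive on the half where its map is used.\<close>
  define \<alpha> where "\<alpha> = (\<lambda>z::real \<times> (nat \<Rightarrow> real). (fst z, (snd z)(0 := max 0 (min 1 (2 * snd z 0)))))"
  define \<beta> where "\<beta> = (\<lambda>z::real \<times> (nat \<Rightarrow> real). (fst z, (snd z)(0 := max 0 (min 1 (2 * snd z 0 - 1)))))"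
  have snd0: "continuous_map ?Z euclideanreal (\<lambda>z. snd z 0)"
    using continuous_map_compose[OF continuous_map_snd unit_cube_coordinate, of 0 k] k by (simp add: o_def)
  have "continuous_map ?Z ?Z \<alpha>" "continuous_map ?Z ?Z \<beta>"
    unfolding \<alpha>_def \<beta>_def
    by (intro continuous_map_pairedI continuous_map_fst continuous_map_cube_first_coordinate[OF k continuous_map_snd]
        continuous_map_real_max continuous_map_real_min continuous_map_diff continuous_map_real_mult
        continuous_map_canonical_const snd0; simp)+
  then have contF: "continuous_map ?Z X (F \<circ> \<alpha>)" and contG: "continuous_map ?Z X (G \<circ> \<beta>)"
    using continuous_map_compose F(1) G(1) by blast+
  have x01: "x 0 \<in> {0..1}" if "x \<in> topspace (unit_cube k)" for x
    using that k by (auto simp: unit_cube_topspace PiE_iff)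
  have "continuous_map ?Z X (\<lambda>z. if snd z 0 \<le> 1 / 2 then (F \<circ> \<alpha>) z else (G \<circ> \<beta>) z)"
  proof (rule continuous_map_cases_le[OF snd0 continuous_map_canonical_const])
    \<comment> \<open>On the seam one map lands on the face with first coordinate 1 and the other on
      the face with first coordinate 0, so both homotopies give \<open>p\<close>.\<close>
    show "(F \<circ> \<alpha>) z = (G \<circ> \<beta>) z" if z: "z \<in> topspace ?Z" "snd z 0 = 1 / 2" for z
    proof -
      have "\<alpha> z = (fst z, (snd z)(0 := 1))" "\<beta> z = (fst z, (snd z)(0 := 0))"
        using z(2) by (simp_all add: \<alpha>_def \<beta>_def)
      moreover have "fst z \<in> {0..1}" "snd z \<in> topspace (unit_cube k)" using z(1) by auto
      ultimately show ?thesis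
        using cube_first_coordinate_endpoint[OF k] by (simp add: F(4) G(4))
    qed
  qed (rule continuous_map_from_subtopology[OF contF] continuous_map_from_subtopology[OF contG])+
  moreover have "(if snd z 0 \<le> 1 / 2 then (F \<circ> \<alpha>) z else (G \<circ> \<beta>) z)
      = cube_concat (\<lambda>x. F (fst z, x)) (\<lambda>x. G (fst z, x)) (snd z)" if "z \<in> topspace ?Z" for z
  proof -
    have "0 \<le> snd z 0" "snd z 0 \<le> 1" using that x01[of "snd z"] by auto
    then have "snd z 0 \<le> 1 / 2 \<Longrightarrow> max 0 (min 1 (2 * snd z 0)) = 2 * snd z 0"
      "\<not> snd z 0 \<le> 1 / 2 \<Longrightarrow> max 0 (min 1 (2 * snd z 0 - 1)) = 2 * snd z 0 - 1"
      by auto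
    then show ?thesis by (simp add: cube_concat_def \<alpha>_def \<beta>_def)
  qed
  ultimately have "continuous_map ?Z X (\<lambda>z. cube_concat (\<lambda>x. F (fst z, x)) (\<lambda>x. G (fst z, x)) (snd z))"
    by (rule continuous_map_eq)
  then show ?thesis
  proof (rule cube_homotopicI)
    fix t x assume t: "t \<in> {0..1::real}" and x: "x \<in> cube_boundary k"
    then have "x 0 \<in> {0..1}" using x01 cube_boundary_subset by blast
    then have "x(0 := 2 * x 0) \<in> cube_boundary k" if "x 0 \<le> 1 / 2"
      using that by (intro cube_first_coordinate_boundary[OF k x]) auto
    moreover have "x(0 := 2 * x 0 - 1) \<in> cube_boundary k" if "\<not> x 0 \<le> 1 / 2"
      using that \<open>x 0 \<in> {0..1}\<close> by (intro cube_first_coordinate_boundary[OF k x]) auto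
    ultimately show "cube_concat (\<lambda>y. F (fst (t, x), y)) (\<lambda>y. G (fst (t, x), y)) (snd (t, x)) = p"
      using t by (simp add: cube_concat_def F(4) G(4))
  qed (simp_all add: F G)
qed

lemma cube_concat_in_cube_maps:
  assumes "k \<ge> 1" "f \<in> cube_maps k X p" "g \<in> cube_maps k X p"
  shows "cube_concat f g \<in> cube_maps k X p"
  using cube_homotopic_concat[of k X p f f g g] assms by (simp add: cube_homotopic_refl)

lemma homotopy_group_mult_class:
  assumes "k \<ge> 1" "f \<in> cube_maps k X p" "g \<in> cube_maps k X p"
  shows "cube_class k X p f \<otimes>\<^bsub>homotopy_group k X p\<^esub> cube_class k X p g = cube_class k X p (cube_concat f g)"
proof (intro equalityI subsetI)
  fix h assume "h \<in> cube_class k X p f \<otimes>\<^bsub>homotopy_group k X p\<^esub> cube_class k X p g"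
  then obtain f' g' where f'g': "cube_homotopic k X p f f'" "cube_homotopic k X p g g'"
    and h: "cube_homotopic k X p (cube_concat f' g') h"
    unfolding homotopy_group_def cube_class_def by auto
  have "cube_homotopic k X p (cube_concat f g) h"
    using cube_homotopic_trans[OF cube_homotopic_concat[OF assms(1) f'g'] h] .
  then show "h \<in> cube_class k X p (cube_concat f g)"
    by (simp add: cube_class_def)
next
  fix h assume "h \<in> cube_class k X p (cube_concat f g)"
  moreover have "f \<in> cube_class k X p f" "g \<in> cube_class k X p g"
    using assms(2,3) by (simp_all add: cube_class_def cube_homotopic_refl)
  ultimately show "h \<in> cube_class k X p f \<otimes>\<^bsub>homotopy_group k X p\<^esub> cube_class k X p g"
    unfolding homotopy_group_def by (simp add: cube_class_def) blast
qed

lemma cube_maps_const: "p \<in> topspace X \<Longrightarrow> (\<lambda>_. p) \<in> cube_maps k X p"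
  by (auto simp: cube_maps_def)

text \<open>The inner function is the standard piecewise linear change of parameter with slopes 2, 1
  and 1/2 and breaks at 1/4 and 1/2. It is concave, hence the minimum of its three affine pieces,
  which makes its continuity immediate.\<close>

lemma cube_concat_assoc:
  "cube_concat (cube_concat f g) h =
    (\<lambda>x. cube_concat f (cube_concat g h) (x(0 := min (2 * x 0) (min (x 0 + 1 / 4) ((x 0 + 1) / 2)))))"
proof
  fix x :: "nat \<Rightarrow> real"
  consider "x 0 \<le> 1 / 4" | "1 / 4 < x 0" "x 0 \<le> 1 / 2" | "1 / 2 < x 0" by linarith
  then show "cube_concat (cube_concat f g) h x =
    cube_concat f (cube_concat g h) (x(0 := min (2 * x 0) (min (x 0 + 1 / 4) ((x 0 + 1) / 2))))"
  proof cases
    case 1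
    then show ?thesis by (simp add: cube_concat_def min_def)
  next
    case 2
    then have "min (2 * x 0) (min (x 0 + 1 / 4) ((x 0 + 1) / 2)) = x 0 + 1 / 4"
      "2 * (2 * x 0) - 1 = 2 * (2 * (x 0 + 1 / 4) - 1)" by auto
    then show ?thesis using 2 by (simp add: cube_concat_def)
  next
    case 3
    then have "min (2 * x 0) (min (x 0 + 1 / 4) ((x 0 + 1) / 2)) = (x 0 + 1) / 2"
      "2 * x 0 - 1 = 2 * (2 * ((x 0 + 1) / 2) - 1) - 1" by auto
    then show ?thesis using 3 by (simp add: cube_concat_def add_divide_distrib)
  qed
qed

theorem group_homotopy_group:
  assumes k: "k \<ge> 1" and p: "p \<in> topspace X"
  shows "group (homotopy_group k X p)"
proof -
  let ?G = "homotopy_group k X p" and ?C = "cube_class k X p"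
  have carrier: "carrier ?G = ?C ` cube_maps k X p"
    by (simp add: homotopy_group_def homotopy_set_eq)
  have one: "\<one>\<^bsub>?G\<^esub> = ?C (\<lambda>_. p)"
    by (simp add: homotopy_group_def cube_class_def)
  note mult = homotopy_group_mult_class[OF k, where X = X and p = p]
  note concat = cube_concat_in_cube_maps[OF k, where X = X and p = p]
  note const = cube_maps_const[OF p, of k]
  show ?thesis
  proof (rule groupI)
    show "\<one>\<^bsub>?G\<^esub> \<in> carrier ?G" using const by (simp add: one carrier)
    show "a \<otimes>\<^bsub>?G\<^esub> b \<in> carrier ?G" if "a \<in> carrier ?G" "b \<in> carrier ?G" for a b
      using that concat by (auto simp: carrier mult)
    show "a \<otimes>\<^bsub>?G\<^esub> b \<otimes>\<^bsub>?G\<^esub> c = a \<otimes>\<^bsub>?G\<^esub> (b \<otimes>\<^bsub>?G\<^esub> c)"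
      if abc: "a \<in> carrier ?G" "b \<in> carrier ?G" "c \<in> carrier ?G" for a b c
    proof -
      obtain f g h where fgh: "f \<in> cube_maps k X p" "g \<in> cube_maps k X p" "h \<in> cube_maps k X p"
        "a = ?C f" "b = ?C g" "c = ?C h"
        using abc unfolding carrier by blast
      \<comment> \<open>The trivial update \<open>x(0 := x 0)\<close> presents the right-hand side
        as a reparametrization by the identity.\<close>
      have "cube_homotopic k X p (cube_concat (cube_concat f g) h)
          (\<lambda>x. cube_concat f (cube_concat g h) (x(0 := x 0)))"
        unfolding cube_concat_assoc
      proof (rule cube_homotopic_reparametrize[OF k])
        show "continuous_on UNIV (\<lambda>s::real. min (2 * s) (min (s + 1 / 4) ((s + 1) / 2)))"
          by (intro continuous_intros) auto
      qed (auto simp: min_def intro!: concat fgh)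
      then show ?thesis
        using fgh by (simp add: mult concat cube_class_eq_iff)
    qed
    show "\<one>\<^bsub>?G\<^esub> \<otimes>\<^bsub>?G\<^esub> a = a" if a: "a \<in> carrier ?G" for a
    proof -
      obtain f where f: "f \<in> cube_maps k X p" "a = ?C f"
        using a unfolding carrier by blast
      \<comment> \<open>Prefixing the constant map amounts to collapsing the first half of the
        parameter interval to 0, a face on which \<open>f\<close> is \<open>p\<close>.\<close>
      have "cube_homotopic k X p (cube_concat (\<lambda>_. p) f) (\<lambda>x. f (x(0 := max 0 (2 * x 0 - 1))))"
      proof (rule cube_homotopic_eq_on[OF concat[OF const f(1)]])
        fix x assume "x \<in> topspace (unit_cube k)"
        then have "f (x(0 := 0)) = p"
          using f(1) cube_first_coordinate_endpoint[OF k, of x 0] by (auto simp: cube_maps_def)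
        moreover have "max 0 (2 * x 0 - 1) = (if x 0 \<le> 1 / 2 then 0 else 2 * x 0 - 1)"
          by auto
        ultimately show "cube_concat (\<lambda>_. p) f x = f (x(0 := max 0 (2 * x 0 - 1)))"
          by (simp add: cube_concat_def)
      qed
      moreover have "cube_homotopic k X p (\<lambda>x. f (x(0 := max 0 (2 * x 0 - 1)))) (\<lambda>x. f (x(0 := x 0)))"
        by (rule cube_homotopic_reparametrize[OF k f(1)]) (auto intro!: continuous_intros)
      ultimately have "cube_homotopic k X p (cube_concat (\<lambda>_. p) f) (\<lambda>x. f (x(0 := x 0)))"
        by (rule cube_homotopic_trans)
      then show ?thesis
        using f const by (simp add: one mult concat cube_class_eq_iff)
    qed
    show "\<exists>b\<in>carrier ?G. b \<otimes>\<^bsub>?G\<^esub> a = \<one>\<^bsub>?G\<^esub>" if a: "a \<in> carrier ?G" for a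
    proof -
      obtain f where f: "f \<in> cube_maps k X p" "a = ?C f"
        using a unfolding carrier by blast
      define f' where "f' = (\<lambda>x. f (x(0 := 1 - x 0)))"
      have f': "f' \<in> cube_maps k X p"
        unfolding f'_def by (rule cube_maps_reparametrize[OF k f(1)]) (auto intro!: continuous_intros)
      \<comment> \<open>The concatenation runs from 1 to 0 and back along the first coordinate.
        Since \<open>\<bar>1 - 2 * s\<bar>\<close> is 1 at both ends, it can be deformed to the
        constant 1.\<close>
      have "cube_concat f' f = (\<lambda>x. f (x(0 := \<bar>1 - 2 * x 0\<bar>)))"
        by (auto simp: cube_concat_def f'_def abs_if fun_eq_iff)
      moreover have "cube_homotopic k X p (\<lambda>x. f (x(0 := \<bar>1 - 2 * x 0\<bar>))) (\<lambda>x. f (x(0 := 1)))"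
        by (rule cube_homotopic_reparametrize[OF k f(1)]) (auto intro!: continuous_intros)
      moreover have "cube_homotopic k X p (\<lambda>x. f (x(0 := 1))) (\<lambda>_. p)"
      proof (rule cube_homotopic_eq_on)
        show "(\<lambda>x. f (x(0 := 1))) \<in> cube_maps k X p"
          by (rule cube_maps_reparametrize[OF k f(1)]) auto
        show "f (x(0 := 1)) = p" if "x \<in> topspace (unit_cube k)" for x
          using that f(1) cube_first_coordinate_endpoint[OF k, of x 1] by (auto simp: cube_maps_def)
      qed
      ultimately have "cube_homotopic k X p (cube_concat f' f) (\<lambda>_. p)"
        using cube_homotopic_trans by simp
      then have "?C f' \<otimes>\<^bsub>?G\<^esub> a = \<one>\<^bsub>?G\<^esub>"
        using f f' by (simp add: one mult concat cube_class_eq_iff)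
      then show ?thesis
        using f' by (auto simp: carrier)
    qed
  qed
qed

section \<open>Induced maps on homotopy sets and groups\<close>

lemma homotopy_map_funcset:
  assumes "continuous_map X Y j" "j p = q"
  shows "homotopy_map k Y q j \<in> homotopy_set k X p \<rightarrow> homotopy_set k Y q"
  using assms by (auto simp: homotopy_set_eq homotopy_map_cube_class cube_maps_compose)

lemma homotopy_map_hom:
  assumes k: "k \<ge> 1" and j: "continuous_map X Y j" "j p = q"
  shows "homotopy_map k Y q j \<in> hom (homotopy_group k X p) (homotopy_group k Y q)"
proof (rule homI)
  show "homotopy_map k Y q j a \<in> carrier (homotopy_group k Y q)" if "a \<in> carrier (homotopy_group k X p)" for a
    using that homotopy_map_funcset[OF j, of k] by (auto simp: homotopy_group_def)
  fix a b assume "a \<in> carrier (homotopy_group k X p)" "b \<in> carrier (homotopy_group k X p)"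
  then obtain f g where fg: "f \<in> cube_maps k X p" "g \<in> cube_maps k X p" "a = cube_class k X p f" "b = cube_class k X p g"
    by (auto simp: homotopy_group_def homotopy_set_eq)
  moreover have "j \<circ> cube_concat f g = cube_concat (j \<circ> f) (j \<circ> g)"
    by (auto simp: cube_concat_def)
  ultimately show "homotopy_map k Y q j (a \<otimes>\<^bsub>homotopy_group k X p\<^esub> b) =
      homotopy_map k Y q j a \<otimes>\<^bsub>homotopy_group k Y q\<^esub> homotopy_map k Y q j b"
    by (simp add: homotopy_group_mult_class[OF k] homotopy_map_cube_class[OF _ j] cube_maps_compose[OF _ j]
        cube_concat_in_cube_maps[OF k])
qed

lemma homotopy_map_comp:
  assumes "continuous_map X Y (\<lambda>x. x)" "continuous_map Y Z (\<lambda>x. x)" "a \<in> homotopy_set k X p"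
  shows "homotopy_map k Z p (\<lambda>x. x) (homotopy_map k Y p (\<lambda>x. x) a) = homotopy_map k Z p (\<lambda>x. x) a"
proof -
  obtain f where f: "f \<in> cube_maps k X p" "a = cube_class k X p f"
    using assms(3) unfolding homotopy_set_eq by blast
  have XZ: "continuous_map X Z (\<lambda>x. x)"
    using continuous_map_compose[OF assms(1,2)] by (simp add: o_def)
  have "f \<in> cube_maps k Y p" using cube_maps_compose[OF f(1) assms(1), of p] by (simp add: o_def)
  then show ?thesis
    using f homotopy_map_cube_class[OF _ assms(2), of f k p p] homotopy_map_cube_class[OF f(1) assms(1), of p]
      homotopy_map_cube_class[OF f(1) XZ, of p] by (simp add: o_def)
qed

lemma homotopy_map_ident:
  assumes "a \<in> homotopy_set k X p"
  shows "homotopy_map k X p (\<lambda>x. x) a = a"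
proof -
  obtain f where f: "f \<in> cube_maps k X p" "a = cube_class k X p f"
    using assms unfolding homotopy_set_eq by blast
  then show ?thesis
    using homotopy_map_cube_class[OF f(1), of X "\<lambda>x. x" p] by (simp add: o_def)
qed

section \<open>Direct limits\<close>

text \<open>The concrete description of a direct limit: every element comes from some stage, and
  elements identified in the limit are identified at a later stage. Surjectivity forces the values
  of the mediating map, hence its uniqueness.\<close>

lemma direct_limit_setsI:
  assumes sys: "direct_system_sets I leq A \<beta>" and coc: "cocone_sets I leq A \<beta> L \<psi>"
    and surj: "\<And>y. y \<in> L \<Longrightarrow> \<exists>i\<in>I. \<exists>x\<in>A i. \<psi> i x = y"
    and inj: "\<And>i x x'. \<lbrakk>i \<in> I; x \<in> A i; x' \<in> A i; \<psi> i x = \<psi> i x'\<rbrakk> \<Longrightarrow> \<exists>j\<in>I. leq i j \<and> \<beta> i j x = \<beta> i j x'"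
  shows "direct_limit_sets TYPE('c) I leq A \<beta> L \<psi>"
  unfolding direct_limit_sets_def
proof (intro conjI allI impI sys coc)
  fix S :: "'c set" and \<phi> assume \<phi>: "cocone_sets I leq A \<beta> S \<phi>"
  have "\<forall>i\<in>I. \<forall>j\<in>I. \<exists>l\<in>I. leq i l \<and> leq j l"
    using sys unfolding direct_system_sets_def directed_index_def by (elim conjE)
  then have dir: "\<exists>l\<in>I. leq i l \<and> leq j l" if "i \<in> I" "j \<in> I" for i j
    using that by blast
  have "\<forall>i\<in>I. \<forall>j\<in>I. leq i j \<longrightarrow> \<beta> i j \<in> A i \<rightarrow> A j"
    using sys unfolding direct_system_sets_def by (elim conjE)
  then have \<beta>: "\<beta> i j x \<in> A j" if "i \<in> I" "j \<in> I" "leq i j" "x \<in> A i" for i j x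
    using that by blast
  have \<psi>\<beta>: "\<psi> j (\<beta> i j x) = \<psi> i x" if "i \<in> I" "j \<in> I" "leq i j" "x \<in> A i" for i j x
    using coc that by (simp add: cocone_sets_def)
  have \<phi>\<beta>: "\<phi> j (\<beta> i j x) = \<phi> i x" if "i \<in> I" "j \<in> I" "leq i j" "x \<in> A i" for i j x
    using \<phi> that by (simp add: cocone_sets_def)
  have \<psi>L: "\<psi> i x \<in> L" and \<phi>S: "\<phi> i x \<in> S" if "i \<in> I" "x \<in> A i" for i x
    using coc \<phi> that unfolding cocone_sets_def by blast+
  \<comment> \<open>\<open>inj\<close> compares elements of one stage. Elements of different stages
    are first moved to a common stage \<open>l\<close> and then identified at some \<open>m\<close>
    beyond it.\<close>
  have wd: "\<phi> i x = \<phi> j x'" if ij: "i \<in> I" "j \<in> I" "x \<in> A i" "x' \<in> A j" "\<psi> i x = \<psi> j x'" for i j x x'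
  proof -
    obtain l where l: "l \<in> I" "leq i l" "leq j l" using dir[OF ij(1,2)] by blast
    have in_l: "\<beta> i l x \<in> A l" "\<beta> j l x' \<in> A l" using \<beta> ij l by auto
    moreover have "\<psi> l (\<beta> i l x) = \<psi> l (\<beta> j l x')" using \<psi>\<beta> ij l by simp
    ultimately obtain m where m: "m \<in> I" "leq l m" "\<beta> l m (\<beta> i l x) = \<beta> l m (\<beta> j l x')"
      using inj[OF l(1)] by blast
    have "\<phi> i x = \<phi> m (\<beta> l m (\<beta> i l x))"
      using \<phi>\<beta>[OF l(1) m(1,2) in_l(1)] \<phi>\<beta>[OF ij(1) l(1,2) ij(3)] by simp
    also have "\<dots> = \<phi> j x'"
      unfolding m(3) using \<phi>\<beta>[OF l(1) m(1,2) in_l(2)] \<phi>\<beta>[OF ij(2) l(1,3) ij(4)] by simp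
    finally show ?thesis .
  qed
  have "\<forall>y\<in>L. \<exists>s. \<forall>i\<in>I. \<forall>x\<in>A i. \<psi> i x = y \<longrightarrow> \<phi> i x = s"
  proof
    fix y assume y: "y \<in> L"
    obtain i x where ix: "i \<in> I" "x \<in> A i" "\<psi> i x = y" using surj[OF y] by blast
    show "\<exists>s. \<forall>i\<in>I. \<forall>x\<in>A i. \<psi> i x = y \<longrightarrow> \<phi> i x = s"
      by (rule exI[of _ "\<phi> i x"]) (use wd[OF _ ix(1) _ ix(2)] ix(3) in simp)
  qed
  then have "\<exists>h. \<forall>y\<in>L. \<forall>i\<in>I. \<forall>x\<in>A i. \<psi> i x = y \<longrightarrow> \<phi> i x = h y"
    by (rule bchoice)
  then obtain h where h: "\<forall>y\<in>L. \<forall>i\<in>I. \<forall>x\<in>A i. \<psi> i x = y \<longrightarrow> \<phi> i x = h y" by blast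
  have h_eq: "h (\<psi> i x) = \<phi> i x" if "i \<in> I" "x \<in> A i" for i x
    using h[rule_format, OF \<psi>L[OF that] that refl] by simp
  show "\<exists>!h. h \<in> L \<rightarrow>\<^sub>E S \<and> (\<forall>i\<in>I. \<forall>x\<in>A i. h (\<psi> i x) = \<phi> i x)"
  proof (rule ex1I[of _ "restrict h L"])
    have "h y \<in> S" if y: "y \<in> L" for y
    proof -
      obtain i x where "i \<in> I" "x \<in> A i" "\<psi> i x = y" using surj[OF y] by blast
      then show ?thesis using h_eq[of i x] \<phi>S[of i x] by simp
    qed
    then show "restrict h L \<in> L \<rightarrow>\<^sub>E S \<and> (\<forall>i\<in>I. \<forall>x\<in>A i. restrict h L (\<psi> i x) = \<phi> i x)"
      using h_eq \<psi>L by simp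
  next
    fix h' assume h': "h' \<in> L \<rightarrow>\<^sub>E S \<and> (\<forall>i\<in>I. \<forall>x\<in>A i. h' (\<psi> i x) = \<phi> i x)"
    show "h' = restrict h L"
    proof
      fix y show "h' y = restrict h L y"
      proof (cases "y \<in> L")
        case True
        then obtain i x where "i \<in> I" "x \<in> A i" "\<psi> i x = y" using surj by blast
        then show ?thesis using h' h_eq True by auto
      next
        case False
        then show ?thesis using h' by (auto simp: PiE_iff extensional_def)
      qed
    qed
  qed
qed

text \<open>The mediating map of the underlying sets is automatically a homomorphism: two elements
  of the limit come from one common stage, and the maps from that stage to \<open>L\<close> and to
  \<open>H\<close> are homomorphisms.\<close>

lemma direct_limit_groupsI:
  assumes sys: "direct_system_groups I leq G \<beta>" and coc: "cocone_groups I leq G \<beta> L \<psi>"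
    and surj: "\<And>y. y \<in> carrier L \<Longrightarrow> \<exists>i\<in>I. \<exists>x\<in>carrier (G i). \<psi> i x = y"
    and inj: "\<And>i x x'. \<lbrakk>i \<in> I; x \<in> carrier (G i); x' \<in> carrier (G i); \<psi> i x = \<psi> i x'\<rbrakk> \<Longrightarrow>
      \<exists>j\<in>I. leq i j \<and> \<beta> i j x = \<beta> i j x'"
  shows "direct_limit_groups TYPE('c) I leq G \<beta> L \<psi>"
  unfolding direct_limit_groups_def
proof (intro conjI allI impI sys coc)
  fix H :: "'c monoid" and \<phi> assume \<phi>: "cocone_groups I leq G \<beta> H \<phi>"
  have "direct_limit_sets TYPE('c) I leq (\<lambda>i. carrier (G i)) \<beta> (carrier L) \<psi>"
    using sys coc by (intro direct_limit_setsI surj inj) (auto simp: direct_system_groups_def cocone_groups_def)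
  then have ex1: "\<exists>!h. h \<in> carrier L \<rightarrow>\<^sub>E carrier H \<and> (\<forall>i\<in>I. \<forall>x\<in>carrier (G i). h (\<psi> i x) = \<phi> i x)"
    using \<phi> by (simp add: direct_limit_sets_def cocone_groups_def)
  have "h \<in> hom L H"
    if h: "h \<in> carrier L \<rightarrow>\<^sub>E carrier H" "\<And>i x. i \<in> I \<Longrightarrow> x \<in> carrier (G i) \<Longrightarrow> h (\<psi> i x) = \<phi> i x" for h
  proof (rule homI)
    show "h a \<in> carrier H" if "a \<in> carrier L" for a using h(1) that by auto
    fix a b assume a: "a \<in> carrier L" and b: "b \<in> carrier L"
    obtain i x where ix: "i \<in> I" "x \<in> carrier (G i)" "\<psi> i x = a"
      using surj[OF a] by blast
    obtain j x' where jx: "j \<in> I" "x' \<in> carrier (G j)" "\<psi> j x' = b"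
      using surj[OF b] by blast
    have "\<forall>i\<in>I. \<forall>j\<in>I. \<exists>l\<in>I. leq i l \<and> leq j l"
      using sys unfolding direct_system_groups_def direct_system_sets_def directed_index_def by (elim conjE)
    then obtain l where l: "l \<in> I" "leq i l" "leq j l"
      using ix(1) jx(1) by blast
    define u v where "u = \<beta> i l x" and "v = \<beta> j l x'"
    have "\<forall>i\<in>I. \<forall>j\<in>I. leq i j \<longrightarrow> \<beta> i j \<in> carrier (G i) \<rightarrow> carrier (G j)"
      using sys unfolding direct_system_groups_def direct_system_sets_def by (elim conjE)
    then have uv: "u \<in> carrier (G l)" "v \<in> carrier (G l)"
      using ix jx l unfolding u_def v_def by blast+
    have ab: "\<psi> l u = a" "\<psi> l v = b"
      using coc ix jx l unfolding u_def v_def cocone_groups_def cocone_sets_def by auto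
    have G: "group (G l)" using sys l(1) by (simp add: direct_system_groups_def)
    have \<psi>l: "\<psi> l \<in> hom (G l) L" and \<phi>l: "\<phi> l \<in> hom (G l) H"
      using coc \<phi> l(1) by (auto simp: cocone_groups_def)
    have "h (a \<otimes>\<^bsub>L\<^esub> b) = h (\<psi> l (u \<otimes>\<^bsub>G l\<^esub> v))"
      using hom_mult[OF \<psi>l uv] ab by simp
    also have "\<dots> = \<phi> l (u \<otimes>\<^bsub>G l\<^esub> v)"
      using h(2)[OF l(1)] uv G by (simp add: group.is_monoid monoid.m_closed)
    also have "\<dots> = \<phi> l u \<otimes>\<^bsub>H\<^esub> \<phi> l v"
      by (rule hom_mult[OF \<phi>l uv])
    finally show "h (a \<otimes>\<^bsub>L\<^esub> b) = h a \<otimes>\<^bsub>H\<^esub> h b"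
      using h(2)[OF l(1) uv(1)] h(2)[OF l(1) uv(2)] ab by simp
  qed
  then have "h \<in> carrier L \<rightarrow>\<^sub>E carrier H \<and> (\<forall>i\<in>I. \<forall>x\<in>carrier (G i). h (\<psi> i x) = \<phi> i x) \<longleftrightarrow>
      h \<in> hom L H \<and> h \<in> extensional (carrier L) \<and> (\<forall>i\<in>I. \<forall>x\<in>carrier (G i). h (\<psi> i x) = \<phi> i x)" for h
    by (auto simp: PiE_iff hom_carrier hom_def)
  with ex1 show "\<exists>!h. h \<in> hom L H \<and> h \<in> extensional (carrier L) \<and> (\<forall>i\<in>I. \<forall>x\<in>carrier (G i). h (\<psi> i x) = \<phi> i x)"
    by simp
qed

section \<open>Restricting the target, and homotopies as maps of a cube of one dimension
  more\<close>

lemma cube_maps_top_of_set_Int: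
  "f \<in> cube_maps k (top_of_set (U \<inter> F)) p \<longleftrightarrow>
     f \<in> cube_maps k (top_of_set U) p \<and> f ` topspace (unit_cube k) \<subseteq> F"
  by (auto simp: cube_maps_def continuous_map_in_subtopology image_subset_iff)

lemma continuous_map_top_of_set_id: "A \<subseteq> B \<Longrightarrow> continuous_map (top_of_set A) (top_of_set B) (\<lambda>x. x)"
  by (auto simp: continuous_map_subtopology_eu)

text \<open>Time becomes the last coordinate, with index \<open>k\<close>, so the space coordinates
  keep their indices; the restriction restores the default value at \<open>k\<close> that points of
  the smaller cube must have.\<close>

lemma continuous_map_unit_cube_Suc:
  "continuous_map (unit_cube (Suc k)) (prod_topology (top_of_set {0..1}) (unit_cube k)) (\<lambda>z. (z k, restrict z {..<k}))"
proof (rule continuous_map_pairedI)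
  have "(\<lambda>z. z k) \<in> topspace (unit_cube (Suc k)) \<rightarrow> {0..1}"
    unfolding unit_cube_topspace by (intro funcsetI) (erule PiE_mem, simp)
  then show "continuous_map (unit_cube (Suc k)) (top_of_set {0..1}) (\<lambda>z. z k)"
    using unit_cube_coordinate[of k "Suc k"] by (simp only: continuous_map_in_subtopology lessI simp_thms)
  show "continuous_map (unit_cube (Suc k)) (unit_cube k) (\<lambda>z. restrict z {..<k})"
    unfolding continuous_map_into_unit_cube
  proof (intro conjI allI impI)
    show "(\<lambda>z. restrict z {..<k}) \<in> topspace (unit_cube (Suc k)) \<rightarrow> topspace (unit_cube k)"
      unfolding unit_cube_topspace by (intro funcsetI restrict_PiE_iff[THEN iffD2] ballI) (erule PiE_mem, simp)
    show "continuous_map (unit_cube (Suc k)) euclideanreal (\<lambda>z. restrict z {..<k} i)" if "i < k" for i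
      using that unit_cube_coordinate[of i "Suc k"] by simp
  qed
qed

lemma continuous_map_unit_cube_Suc':
  "continuous_map (prod_topology (top_of_set {0..1}) (unit_cube k)) (unit_cube (Suc k)) (\<lambda>z. (snd z)(k := fst z))"
  unfolding continuous_map_into_unit_cube
proof (intro conjI allI impI)
  let ?Z = "prod_topology (top_of_set {0..1::real}) (unit_cube k)"
  show "(\<lambda>z. (snd z)(k := fst z)) \<in> topspace ?Z \<rightarrow> topspace (unit_cube (Suc k))"
  proof (intro funcsetI)
    fix z assume "z \<in> topspace ?Z"
    then have "fst z \<in> {0..1}" "snd z \<in> {..<k} \<rightarrow>\<^sub>E {0..1}"
      by (simp_all add: unit_cube_topspace mem_Times_iff)
    then show "(snd z)(k := fst z) \<in> topspace (unit_cube (Suc k))"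
      unfolding unit_cube_topspace lessThan_Suc by (intro PiE_fun_upd)
  qed
  fix i assume "i < Suc k"
  show "continuous_map ?Z euclideanreal (\<lambda>z. ((snd z)(k := fst z)) i)"
  proof (cases "i = k")
    case True
    then show ?thesis
      using continuous_map_fst[of "top_of_set {0..1::real}" "unit_cube k"]
      by (simp add: continuous_map_in_subtopology)
  next
    case False
    then show ?thesis
      using continuous_map_compose[OF continuous_map_snd unit_cube_coordinate, of i k] \<open>i < Suc k\<close>
      by (simp add: o_def)
  qed
qed

section \<open>Dense subspaces\<close>

locale dense_subspace =
  fixes U E :: "'a::real_tvs set"
  assumes hulls: "small_convex_hulls U" and subspace: "subspace E" and dense: "U \<subseteq> closure (U \<inter> E)"
begin

abbreviation "subs p \<equiv> fin_dim_subspaces_at E p"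

abbreviation "UE \<equiv> subtopology (finite_topology E) (U \<inter> E)"

text \<open>The approximation starts from \<open>span {p}\<close>, which contains the boundary
  values and ensures that \<open>p\<close> lies in \<open>G\<close> even for \<open>k = 0\<close>,
  where the boundary is empty.\<close>

lemma cube_map_homotopic_into_fin_dim:
  assumes p: "p \<in> U \<inter> E" and f: "f \<in> cube_maps k (top_of_set U) p"
  obtains G g where "G \<in> subs p" "g \<in> cube_maps k (top_of_set (U \<inter> G)) p"
    "cube_homotopic k (top_of_set U) p f g"
proof -
  have "fin_dim_subspace (span {p})" by (auto simp: fin_dim_subspace_def)
  moreover have "span {p} \<subseteq> E" using p subspace by (intro span_minimal) auto
  moreover have "f ` cube_boundary k \<subseteq> span {p}"
    using f span_base[of p "{p}"] by (auto simp: cube_maps_def)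
  moreover have "continuous_map (unit_cube k) (top_of_set U) f"
    using f by (simp add: cube_maps_def)
  ultimately obtain G h where G: "fin_dim_subspace G" "span {p} \<subseteq> G" "G \<subseteq> E"
    and h: "continuous_map (prod_topology (top_of_set {0..1}) (unit_cube k)) (top_of_set U) h"
      "\<And>x. h (0::real, x) = f x"
      "\<And>x. x \<in> topspace (unit_cube k) \<Longrightarrow> h (1, x) \<in> G"
      "\<And>t x. x \<in> cube_boundary k \<Longrightarrow> h (t, x) = f x"
    using approximate_cube_map[OF hulls subspace dense, of k f "span {p}"] by blast
  have hom: "cube_homotopic k (top_of_set U) p f (\<lambda>x. h (1, x))"
    by (rule cube_homotopicI[OF h(1)]) (use h f in \<open>auto simp: cube_maps_def\<close>)
  moreover have "G \<in> subs p"
    using G span_base[of p "{p}"] by (auto simp: fin_dim_subspaces_at_def)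
  moreover have "(\<lambda>x. h (1, x)) \<in> cube_maps k (top_of_set (U \<inter> G)) p"
    unfolding cube_maps_top_of_set_Int using cube_homotopic_imp_cube_maps(2)[OF hom] h(3) by auto
  ultimately show thesis using that by blast
qed

lemma cube_homotopic_in_fin_dim:
  assumes F: "F \<in> subs p" and fg: "f \<in> cube_maps k (top_of_set (U \<inter> F)) p" "g \<in> cube_maps k (top_of_set (U \<inter> F)) p"
    and hom: "cube_homotopic k (top_of_set U) p f g"
  obtains G where "G \<in> subs p" "F \<subseteq> G" "cube_homotopic k (top_of_set (U \<inter> G)) p f g"
proof -
  let ?Z = "prod_topology (top_of_set {0..1::real}) (unit_cube k)"
  obtain H where H: "continuous_map ?Z (top_of_set U) H" "\<And>x. H (0, x) = f x" "\<And>x. H (1, x) = g x"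
    "\<And>t x. t \<in> {0..1} \<Longrightarrow> x \<in> cube_boundary k \<Longrightarrow> H (t, x) = p"
    using cube_homotopicE[OF hom] by blast
  \<comment> \<open>\<open>K\<close> is the homotopy as a map of the larger cube. On its boundary
    the values are those of \<open>f\<close> and \<open>g\<close> at the two ends in time and
    \<open>p\<close> on the other faces, all in \<open>F\<close>; so the approximation can be made
    relative to the whole boundary.\<close>
  define K where "K = H \<circ> (\<lambda>z. (z k, restrict z {..<k}))"
  have contK: "continuous_map (unit_cube (Suc k)) (top_of_set U) K"
    unfolding K_def by (rule continuous_map_compose[OF continuous_map_unit_cube_Suc H(1)])
  have rest: "restrict z {..<k} \<in> topspace (unit_cube k)" and zk: "z k \<in> {0..1}"
    if "z \<in> topspace (unit_cube (Suc k))" for z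
    using that by (auto simp: unit_cube_topspace PiE_iff)
  have fgF: "f x \<in> F" "g x \<in> F" if "x \<in> topspace (unit_cube k)" for x
    using fg that unfolding cube_maps_top_of_set_Int by blast+
  have F': "fin_dim_subspace F" "F \<subseteq> E" "p \<in> F" using F by (auto simp: fin_dim_subspaces_at_def)
  have "K z \<in> F" if z: "z \<in> cube_boundary (Suc k)" for z
  proof -
    have top: "z \<in> topspace (unit_cube (Suc k))" using z cube_boundary_subset by blast
    obtain i where i: "i < Suc k" "z i = 0 \<or> z i = 1" using z by (auto simp: cube_boundary_def)
    show ?thesis
    proof (cases "i = k")
      case True
      then show ?thesis using i(2) fgF[OF rest[OF top]] by (auto simp: K_def H(2,3))
    next
      case False
      then have "restrict z {..<k} \<in> cube_boundary k"
        using i rest[OF top] unfolding cube_boundary_def by (auto intro!: exI[of _ i])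
      then show ?thesis using H(4)[OF zk[OF top]] F'(3) by (simp add: K_def)
    qed
  qed
  then have "K ` cube_boundary (Suc k) \<subseteq> F" by blast
  then obtain G h where G: "fin_dim_subspace G" "F \<subseteq> G" "G \<subseteq> E"
    and h: "continuous_map (prod_topology (top_of_set {0..1}) (unit_cube (Suc k))) (top_of_set U) h"
      "\<And>x. h (0::real, x) = K x"
      "\<And>x. x \<in> topspace (unit_cube (Suc k)) \<Longrightarrow> h (1, x) \<in> G"
      "\<And>t x. x \<in> cube_boundary (Suc k) \<Longrightarrow> h (t, x) = K x"
    using approximate_cube_map[OF hulls subspace dense contK F'(1,2)] by blast
  have GF: "G \<in> subs p" using G F'(3) by (auto simp: fin_dim_subspaces_at_def)
  \<comment> \<open>The end of the approximating homotopy, read back as a homotopy in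
    \<open>U \<inter> G\<close>; the time parameter of \<open>h\<close> itself is discarded.\<close>
  define L where "L = (\<lambda>z::real \<times> (nat \<Rightarrow> real). h (1, (snd z)(k := fst z)))"
  have h1: "continuous_map (unit_cube (Suc k)) (top_of_set (U \<inter> G)) (\<lambda>x. h (1, x))"
  proof -
    have "continuous_map (unit_cube (Suc k)) (prod_topology (top_of_set {0..1}) (unit_cube (Suc k))) (\<lambda>x. (1::real, x))"
      by (intro continuous_map_pairedI) auto
    from continuous_map_compose[OF this h(1)]
    show ?thesis using h(3) by (auto simp: continuous_map_in_subtopology o_def image_subset_iff)
  qed
  have contL: "continuous_map ?Z (top_of_set (U \<inter> G)) L"
    using continuous_map_compose[OF continuous_map_unit_cube_Suc' h1] by (simp add: L_def o_def)
  have bd: "x(k := t) \<in> cube_boundary (Suc k)"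
    if "x \<in> topspace (unit_cube k)" "t \<in> {0..1}" "x \<in> cube_boundary k \<or> t = 0 \<or> t = 1" for x t
  proof -
    have "x(k := t) \<in> topspace (unit_cube (Suc k))"
      using that(1,2) by (auto simp: unit_cube_topspace PiE_iff extensional_def less_Suc_eq)
    moreover have "\<exists>i<Suc k. (x(k := t)) i = 0 \<or> (x(k := t)) i = 1"
    proof (cases "x \<in> cube_boundary k")
      case True
      then obtain i where "i < k" "x i = 0 \<or> x i = 1" by (auto simp: cube_boundary_def)
      then show ?thesis by (intro exI[of _ i]) auto
    next
      case False
      then show ?thesis using that(3) by (intro exI[of _ k]) auto
    qed
    ultimately show ?thesis by (simp add: cube_boundary_def)
  qed
  have L_eq: "L (t, x) = H (t, x)"
    if x: "x \<in> topspace (unit_cube k)" "t \<in> {0..1}" "x \<in> cube_boundary k \<or> t = 0 \<or> t = 1" for x t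
  proof -
    have "x \<in> extensional {..<k}" using x(1) by (auto simp: unit_cube_topspace PiE_iff)
    then have "restrict (x(k := t)) {..<k} = x" by (auto simp: restrict_def extensional_def fun_eq_iff)
    then show ?thesis using h(4)[OF bd[OF x], of 1] by (simp add: L_def K_def)
  qed
  have fgG: "f \<in> cube_maps k (top_of_set (U \<inter> G)) p" "g \<in> cube_maps k (top_of_set (U \<inter> G)) p"
    using fg G(2) unfolding cube_maps_top_of_set_Int by auto
  \<comment> \<open>\<open>L\<close> is known to agree with \<open>H\<close> only over points of the
    cube, so its ends have to be linked to \<open>f\<close> and \<open>g\<close> separately.\<close>
  have "cube_homotopic k (top_of_set (U \<inter> G)) p f (\<lambda>x. L (0, x))"
    by (rule cube_homotopic_eq_on[OF fgG(1)]) (simp add: L_eq H(2))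
  moreover have "cube_homotopic k (top_of_set (U \<inter> G)) p (\<lambda>x. L (0, x)) (\<lambda>x. L (1, x))"
  proof (rule cube_homotopicI[OF contL])
    show "L (t, x) = p" if "t \<in> {0..1}" "x \<in> cube_boundary k" for t x
      using L_eq[of x t] H(4)[OF that] that cube_boundary_subset by auto
  qed auto
  moreover have "cube_homotopic k (top_of_set (U \<inter> G)) p g (\<lambda>x. L (1, x))"
    by (rule cube_homotopic_eq_on[OF fgG(2)]) (simp add: L_eq H(3))
  ultimately have "cube_homotopic k (top_of_set (U \<inter> G)) p f g"
    by (rule cube_homotopic_trans[OF cube_homotopic_trans cube_homotopic_sym])
  then show thesis using that GF G(2) by blast
qed

section \<open>Comparison of the finite topology with the topology of \<open>U\<close>\<close>

lemma continuous_map_UE: "continuous_map UE (top_of_set U) (\<lambda>x. x)"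
  using continuous_map_from_subtopology[OF continuous_map_finite_topology_euclidean[OF subspace]]
  by (auto simp: continuous_map_in_subtopology)

lemma continuous_map_fin_dim_UE:
  assumes "F \<in> subs p"
  shows "continuous_map (top_of_set (U \<inter> F)) UE (\<lambda>x. x)"
proof -
  have "continuous_map (subtopology (top_of_set F) U) (finite_topology E) (\<lambda>x. x)"
    using assms subspace
    by (intro continuous_map_from_subtopology continuous_map_finite_topology_subspace)
       (auto simp: fin_dim_subspaces_at_def)
  then show ?thesis
    using assms by (auto simp: continuous_map_in_subtopology subtopology_subtopology Int_commute fin_dim_subspaces_at_def)
qed

lemma cube_map_UE_in_fin_dim:
  assumes p: "p \<in> U \<inter> E" and f: "f \<in> cube_maps k UE p"
  obtains F where "F \<in> subs p" "f \<in> cube_maps k (top_of_set (U \<inter> F)) p"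
proof -
  have "continuous_map (unit_cube k) UE f" using f by (simp add: cube_maps_def)
  then have "compactin UE (f ` topspace (unit_cube k))"
    using compact_space_unit_cube image_compactin unfolding compact_space_def by blast
  then have "compactin (finite_topology E) (f ` topspace (unit_cube k))"
    by (simp add: compactin_subtopology)
  then obtain F where F: "fin_dim_subspace F" "F \<subseteq> E" "f ` topspace (unit_cube k) \<subseteq> F"
    using compactin_finite_topology_imp_fin_dim[OF subspace] by blast
  have "span (F \<union> {p}) \<in> subs p"
    using fin_dim_subspace_span_Un[OF F(1), of "{p}"] F(2) p subspace span_minimal[of "F \<union> {p}" E]
      span_base[of p "F \<union> {p}"]
    by (auto simp: fin_dim_subspaces_at_def)
  moreover have "f ` topspace (unit_cube k) \<subseteq> span (F \<union> {p})"
    using F(3) span_superset[of "F \<union> {p}"] by blast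
  moreover have "(\<lambda>x. x) \<circ> f \<in> cube_maps k (top_of_set U) p"
    by (rule cube_maps_compose[OF f continuous_map_UE]) simp
  ultimately show thesis
    using that[of "span (F \<union> {p})"] by (simp add: cube_maps_top_of_set_Int o_def)
qed

text \<open>Both halves pass through finite-dimensional parts, where the two topologies agree. For
  injectivity, directedness puts both representatives into one \<open>U \<inter> F\<close>, and a
  homotopy in \<open>U\<close> is replaced by one in some \<open>U \<inter> G\<close>, which is
  continuous into \<open>UE\<close>.\<close>

lemma bij_betw_homotopy_map_UE:
  assumes p: "p \<in> U \<inter> E"
  shows "bij_betw (homotopy_map k (top_of_set U) p (\<lambda>x. x)) (homotopy_set k UE p) (homotopy_set k (top_of_set U) p)"
proof -
  let ?j = "homotopy_map k (top_of_set U) p (\<lambda>x. x)"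
  have j: "?j (cube_class k UE p f) = cube_class k (top_of_set U) p f" and
    jf: "f \<in> cube_maps k (top_of_set U) p" if "f \<in> cube_maps k UE p" for f
    using homotopy_map_cube_class[OF that continuous_map_UE, of p] cube_maps_compose[OF that continuous_map_UE, of p]
    by (simp_all add: o_def)
  show ?thesis
  proof (rule bij_betw_imageI)
    show "inj_on ?j (homotopy_set k UE p)"
    proof (rule inj_onI)
      fix a b assume "a \<in> homotopy_set k UE p" "b \<in> homotopy_set k UE p" and eq: "?j a = ?j b"
      then obtain f g where f: "f \<in> cube_maps k UE p" "a = cube_class k UE p f"
        and g: "g \<in> cube_maps k UE p" "b = cube_class k UE p g"
        unfolding homotopy_set_eq by blast
      obtain F1 where F1: "F1 \<in> subs p" "f \<in> cube_maps k (top_of_set (U \<inter> F1)) p"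
        by (rule cube_map_UE_in_fin_dim[OF p f(1)])
      obtain F2 where F2: "F2 \<in> subs p" "g \<in> cube_maps k (top_of_set (U \<inter> F2)) p"
        by (rule cube_map_UE_in_fin_dim[OF p g(1)])
      have "directed_index (subs p) (\<subseteq>)"
        using p by (intro fin_dim_subspaces_at_directed[OF subspace]) auto
      then have "\<forall>F\<in>subs p. \<forall>G\<in>subs p. \<exists>H\<in>subs p. F \<subseteq> H \<and> G \<subseteq> H"
        unfolding directed_index_def by (elim conjE)
      then obtain F where F: "F \<in> subs p" "F1 \<subseteq> F" "F2 \<subseteq> F"
        using F1(1) F2(1) by meson
      have fF: "f \<in> cube_maps k (top_of_set (U \<inter> F)) p" and gF: "g \<in> cube_maps k (top_of_set (U \<inter> F)) p"
        using F1(2) F2(2) F(2,3) unfolding cube_maps_top_of_set_Int by blast+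
      have "cube_homotopic k (top_of_set U) p f g"
        using eq f g j jf cube_class_eq_iff[of f k "top_of_set U" p g] by simp
      then obtain G where G: "G \<in> subs p" "cube_homotopic k (top_of_set (U \<inter> G)) p f g"
        using cube_homotopic_in_fin_dim[OF F(1) fF gF] by blast
      have "cube_homotopic k UE p f g"
        using cube_homotopic_compose[OF G(2) continuous_map_fin_dim_UE[OF G(1)], of p] by (simp add: o_def)
      then show "a = b"
        using f g cube_class_eq_iff[of f k UE p g] by simp
    qed
    show "?j ` homotopy_set k UE p = homotopy_set k (top_of_set U) p"
    proof (intro equalityI subsetI)
      fix a assume "a \<in> ?j ` homotopy_set k UE p"
      then obtain f where "f \<in> cube_maps k UE p" "a = ?j (cube_class k UE p f)"
        unfolding homotopy_set_eq by blast
      then show "a \<in> homotopy_set k (top_of_set U) p"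
        using j jf by (simp add: homotopy_set_eq)
    next
      fix a assume "a \<in> homotopy_set k (top_of_set U) p"
      then obtain f where f: "f \<in> cube_maps k (top_of_set U) p" "a = cube_class k (top_of_set U) p f"
        unfolding homotopy_set_eq by blast
      obtain G g where G: "G \<in> subs p" "g \<in> cube_maps k (top_of_set (U \<inter> G)) p"
        and hom: "cube_homotopic k (top_of_set U) p f g"
        by (rule cube_map_homotopic_into_fin_dim[OF p f(1)])
      have "g \<in> cube_maps k UE p"
        using cube_maps_compose[OF G(2) continuous_map_fin_dim_UE[OF G(1)], of p] by (simp add: o_def)
      moreover have "a = cube_class k (top_of_set U) p g"
        using f(2) hom cube_class_eq_iff[OF f(1), of g] by simp
      ultimately show "a \<in> ?j ` homotopy_set k UE p"
        unfolding homotopy_set_eq using j[of g] by (intro image_eqI[of _ _ "cube_class k UE p g"]) auto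
    qed
  qed
qed

section \<open>The direct limit over finite-dimensional subspaces\<close>

lemma homotopy_map_fin_dim_surj:
  assumes p: "p \<in> U \<inter> E" and a: "a \<in> homotopy_set k (top_of_set U) p"
  shows "\<exists>F\<in>subs p. \<exists>x\<in>homotopy_set k (fin_dim_part U F) p. homotopy_map k (top_of_set U) p (\<lambda>x. x) x = a"
proof -
  obtain f where f: "f \<in> cube_maps k (top_of_set U) p" "a = cube_class k (top_of_set U) p f"
    using a unfolding homotopy_set_eq by blast
  obtain G g where G: "G \<in> subs p" "g \<in> cube_maps k (top_of_set (U \<inter> G)) p"
    and hom: "cube_homotopic k (top_of_set U) p f g"
    by (rule cube_map_homotopic_into_fin_dim[OF p f(1)])
  have part: "fin_dim_part U G = top_of_set (U \<inter> G)"
    using G(1) by (simp add: fin_dim_part_eq fin_dim_subspaces_at_def)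
  have "homotopy_map k (top_of_set U) p (\<lambda>x. x) (cube_class k (top_of_set (U \<inter> G)) p g) = cube_class k (top_of_set U) p g"
    using homotopy_map_cube_class[OF G(2) continuous_map_top_of_set_id[of "U \<inter> G" U]] by (simp add: o_def)
  moreover have "\<dots> = a" using f(2) hom cube_class_eq_iff[OF f(1), of g] by simp
  moreover have "cube_class k (top_of_set (U \<inter> G)) p g \<in> homotopy_set k (top_of_set (U \<inter> G)) p"
    using G(2) by (simp add: homotopy_set_eq)
  ultimately show ?thesis
    using G(1) part by (intro bexI[of _ G] bexI[of _ "cube_class k (top_of_set (U \<inter> G)) p g"]) simp_all
qed

text \<open>Together with the preceding surjectivity this supplies the two conditions of the direct
  limit criteria. Equality of the images in \<open>U\<close> yields a homotopy there, which is
  deformed into a larger finite-dimensional part.\<close>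

lemma homotopy_map_fin_dim_inj:
  assumes F: "F \<in> subs p" and ab: "a \<in> homotopy_set k (fin_dim_part U F) p" "b \<in> homotopy_set k (fin_dim_part U F) p"
    and eq: "homotopy_map k (top_of_set U) p (\<lambda>x. x) a = homotopy_map k (top_of_set U) p (\<lambda>x. x) b"
  shows "\<exists>G\<in>subs p. F \<subseteq> G \<and> homotopy_map k (fin_dim_part U G) p (\<lambda>x. x) a = homotopy_map k (fin_dim_part U G) p (\<lambda>x. x) b"
proof -
  have part: "fin_dim_part U G = top_of_set (U \<inter> G)" if "G \<in> subs p" for G
    using that by (simp add: fin_dim_part_eq fin_dim_subspaces_at_def)
  obtain f g where f: "f \<in> cube_maps k (top_of_set (U \<inter> F)) p" "a = cube_class k (top_of_set (U \<inter> F)) p f"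
    and g: "g \<in> cube_maps k (top_of_set (U \<inter> F)) p" "b = cube_class k (top_of_set (U \<inter> F)) p g"
    using ab unfolding part[OF F] homotopy_set_eq by blast
  have j: "homotopy_map k (top_of_set A) p (\<lambda>x. x) (cube_class k (top_of_set (U \<inter> F)) p f') = cube_class k (top_of_set A) p f'"
    if "f' \<in> cube_maps k (top_of_set (U \<inter> F)) p" "U \<inter> F \<subseteq> A" for f' A
    using homotopy_map_cube_class[OF that(1) continuous_map_top_of_set_id[OF that(2)]] by (simp add: o_def)
  have "f \<in> cube_maps k (top_of_set U) p" using f(1) by (simp add: cube_maps_top_of_set_Int)
  then have "cube_homotopic k (top_of_set U) p f g"
    using eq f g j[of _ U] cube_class_eq_iff[of f k "top_of_set U" p g] by simp
  then obtain G where G: "G \<in> subs p" "F \<subseteq> G" "cube_homotopic k (top_of_set (U \<inter> G)) p f g"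
    using cube_homotopic_in_fin_dim[OF F f(1) g(1)] by blast
  have "cube_class k (top_of_set (U \<inter> G)) p f = cube_class k (top_of_set (U \<inter> G)) p g"
    using G(3) cube_class_eq_iff[OF cube_homotopic_imp_cube_maps(1)[OF G(3)]] by simp
  moreover have "U \<inter> F \<subseteq> U \<inter> G" using G(2) by blast
  ultimately have "homotopy_map k (fin_dim_part U G) p (\<lambda>x. x) a = homotopy_map k (fin_dim_part U G) p (\<lambda>x. x) b"
    using f g by (simp add: part[OF G(1)] j)
  then show ?thesis using G(1,2) by blast
qed

lemma continuous_map_fin_dim_part:
  assumes "F \<in> subs p"
  shows "continuous_map (fin_dim_part U F) (top_of_set U) (\<lambda>x. x)"
    and "\<And>G. G \<in> subs p \<Longrightarrow> F \<subseteq> G \<Longrightarrow> continuous_map (fin_dim_part U F) (fin_dim_part U G) (\<lambda>x. x)"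
  using assms by (auto simp: fin_dim_part_eq fin_dim_subspaces_at_def intro!: continuous_map_top_of_set_id)

lemma direct_system_homotopy_sets:
  assumes "p \<in> U \<inter> E"
  shows "direct_system_sets (subs p) (\<subseteq>) (\<lambda>F. homotopy_set k (fin_dim_part U F) p)
           (\<lambda>F G. homotopy_map k (fin_dim_part U G) p (\<lambda>x. x))"
  unfolding direct_system_sets_def
proof (intro conjI ballI impI)
  show "directed_index (subs p) (\<subseteq>)"
    using assms by (intro fin_dim_subspaces_at_directed subspace) auto
  show "homotopy_map k (fin_dim_part U G) p (\<lambda>x. x) \<in> homotopy_set k (fin_dim_part U F) p \<rightarrow> homotopy_set k (fin_dim_part U G) p"
    if "F \<in> subs p" "G \<in> subs p" "F \<subseteq> G" for F G
    by (rule homotopy_map_funcset[OF continuous_map_fin_dim_part(2)[OF that]]) simp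
qed (simp_all add: homotopy_map_ident homotopy_map_comp[OF continuous_map_fin_dim_part(2) continuous_map_fin_dim_part(2)])

lemma cocone_homotopy_sets:
  assumes "p \<in> U \<inter> E"
  shows "cocone_sets (subs p) (\<subseteq>) (\<lambda>F. homotopy_set k (fin_dim_part U F) p)
           (\<lambda>F G. homotopy_map k (fin_dim_part U G) p (\<lambda>x. x))
           (homotopy_set k (top_of_set U) p) (\<lambda>F. homotopy_map k (top_of_set U) p (\<lambda>x. x))"
  unfolding cocone_sets_def
proof (intro conjI ballI impI)
  show "homotopy_map k (top_of_set U) p (\<lambda>x. x) \<in> homotopy_set k (fin_dim_part U F) p \<rightarrow> homotopy_set k (top_of_set U) p"
    if "F \<in> subs p" for F
    by (rule homotopy_map_funcset[OF continuous_map_fin_dim_part(1)[OF that]]) simp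
qed (simp add: homotopy_map_comp[OF continuous_map_fin_dim_part(2) continuous_map_fin_dim_part(1)])

lemma direct_limit_homotopy_sets:
  assumes "p \<in> U \<inter> E"
  shows "direct_limit_sets TYPE('c) (subs p) (\<subseteq>) (\<lambda>F. homotopy_set k (fin_dim_part U F) p)
           (\<lambda>F G. homotopy_map k (fin_dim_part U G) p (\<lambda>x. x))
           (homotopy_set k (top_of_set U) p) (\<lambda>F. homotopy_map k (top_of_set U) p (\<lambda>x. x))"
  by (rule direct_limit_setsI[OF direct_system_homotopy_sets[OF assms] cocone_homotopy_sets[OF assms]
        homotopy_map_fin_dim_surj[OF assms] homotopy_map_fin_dim_inj])

lemma direct_limit_homotopy_groups:
  assumes p: "p \<in> U \<inter> E" and k: "k \<ge> 1"
  shows "direct_limit_groups TYPE('c) (subs p) (\<subseteq>) (\<lambda>F. homotopy_group k (fin_dim_part U F) p)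
           (\<lambda>F G. homotopy_map k (fin_dim_part U G) p (\<lambda>x. x))
           (homotopy_group k (top_of_set U) p) (\<lambda>F. homotopy_map k (top_of_set U) p (\<lambda>x. x))"
proof -
  have carrier: "carrier (homotopy_group k X p) = homotopy_set k X p" for X
    by (simp add: homotopy_group_def)
  have "p \<in> topspace (fin_dim_part U F)" if "F \<in> subs p" for F
    using that p by (auto simp: fin_dim_part_eq fin_dim_subspaces_at_def)
  then have groups: "group (homotopy_group k (fin_dim_part U F) p)" if "F \<in> subs p" for F
    using that by (intro group_homotopy_group[OF k])
  have hom: "homotopy_map k (fin_dim_part U G) p (\<lambda>x. x) \<in>
      hom (homotopy_group k (fin_dim_part U F) p) (homotopy_group k (fin_dim_part U G) p)"
    if "F \<in> subs p" "G \<in> subs p" "F \<subseteq> G" for F G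
    by (rule homotopy_map_hom[OF k continuous_map_fin_dim_part(2)[OF that] refl])
  have hom': "homotopy_map k (top_of_set U) p (\<lambda>x. x) \<in>
      hom (homotopy_group k (fin_dim_part U F) p) (homotopy_group k (top_of_set U) p)"
    if "F \<in> subs p" for F
    by (rule homotopy_map_hom[OF k continuous_map_fin_dim_part(1)[OF that] refl])
  have "direct_system_groups (subs p) (\<subseteq>) (\<lambda>F. homotopy_group k (fin_dim_part U F) p)
      (\<lambda>F G. homotopy_map k (fin_dim_part U G) p (\<lambda>x. x))"
    unfolding direct_system_groups_def carrier
    by (intro conjI ballI impI direct_system_homotopy_sets[OF p] groups hom)
  moreover have "group (homotopy_group k (top_of_set U) p)"
    using p by (intro group_homotopy_group[OF k]) simp
  then have "cocone_groups (subs p) (\<subseteq>) (\<lambda>F. homotopy_group k (fin_dim_part U F) p)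
      (\<lambda>F G. homotopy_map k (fin_dim_part U G) p (\<lambda>x. x))
      (homotopy_group k (top_of_set U) p) (\<lambda>F. homotopy_map k (top_of_set U) p (\<lambda>x. x))"
    unfolding cocone_groups_def carrier
    by (intro conjI ballI impI cocone_homotopy_sets[OF p] hom')
  ultimately show ?thesis
  proof (rule direct_limit_groupsI, unfold carrier)
  qed (erule homotopy_map_fin_dim_surj[OF p], rule homotopy_map_fin_dim_inj)
qed

lemma weak_homotopy_equivalence_UE: "weak_homotopy_equivalence UE (top_of_set U) (\<lambda>x. x)"
  unfolding weak_homotopy_equivalence_def
  using bij_betw_homotopy_map_UE continuous_map_UE by simp

end

theorem corollary1p14:
  fixes U E_inf :: "'a::real_tvs set"
  assumes "open U \<or> semi_locally_convex U"
    and "subspace E_inf"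
    and "U \<subseteq> closure (U \<inter> E_inf)"
  shows "weak_homotopy_equivalence
           (subtopology (finite_topology E_inf) (U \<inter> E_inf)) (top_of_set U) (\<lambda>x. x) \<and>
         (\<forall>p \<in> U \<inter> E_inf.
           direct_limit_sets TYPE('c) (fin_dim_subspaces_at E_inf p) (\<subseteq>)
             (\<lambda>F. homotopy_set 0 (fin_dim_part U F) p)
             (\<lambda>F G. homotopy_map 0 (fin_dim_part U G) p (\<lambda>x. x))
             (homotopy_set 0 (top_of_set U) p)
             (\<lambda>F. homotopy_map 0 (top_of_set U) p (\<lambda>x. x))) \<and>
         (\<forall>p \<in> U \<inter> E_inf. \<forall>k\<ge>1.
           direct_limit_groups TYPE('c) (fin_dim_subspaces_at E_inf p) (\<subseteq>)
             (\<lambda>F. homotopy_group k (fin_dim_part U F) p)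
             (\<lambda>F G. homotopy_map k (fin_dim_part U G) p (\<lambda>x. x))
             (homotopy_group k (top_of_set U) p)
             (\<lambda>F. homotopy_map k (top_of_set U) p (\<lambda>x. x)))"
proof -
  \<comment> \<open>The alternative between open and semi-locally convex \<open>U\<close> enters
    only here, through \<open>small_convex_hulls\<close>.\<close>
  interpret dense_subspace U E_inf
    using assms by unfold_locales
      (auto intro: open_imp_small_convex_hulls semi_locally_convex_imp_small_convex_hulls)
  show ?thesis
    by (intro conjI ballI allI impI weak_homotopy_equivalence_UE direct_limit_homotopy_sets
        direct_limit_homotopy_groups)
qed

end
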